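(* Let $\Bbbk$ be an algebraically closed field of characteristic $0$, let $P=\Bbbk[x_1,x_2,x_3]$ be a quadratic Poisson algebra and let $P_\hbar$ ($\hbar\in\Bbbk^\times$) be its standard deformation quantization. Then $\mathrm{Aut}_{\mathrm{gr}}(P_\hbar)\cong\mathrm{PAut}_{\mathrm{gr}}(P)$ as groups.
   Context: $P=\Bbbk[x_1,x_2,x_3]$ carries the standard grading ($\deg x_i=1$) and a Poisson bracket (a Lie bracket satisfying the Leibniz rule $\{a,bc\}=b\{a,c\}+\{a,b\}c$); it is quadratic if $\{P_1,P_1\}\subseteq P_2$. Write $\{x_i,x_j\}=\sum_{k,l}c_{i,j}^{k,l}x_kx_l$ with $c_{i,j}^{k,l}\in\Bbbk$. The standard deformation quantization of $P$, for $\hbar\in\Bbbk^\times$, is $$P_\hbar=\Bbbk\langle y_1,y_2,y_3\rangle\Big/\Big([y_i,y_j]=\tfrac{\hbar}{2}\sum_{k,l}c_{i,j}^{k,l}(y_ky_l+y_ly_k)\Big)_{1\le i,j\le 3},$$ graded by $\deg y_i=1$. $\mathrm{PAut}_{\mathrm{gr}}(P)$ is the group of graded Poisson algebra automorphisms of $P$ and $\mathrm{Aut}_{\mathrm{gr}}(P_\hbar)$ is the group of graded $\Bbbk$-algebra automorphisms of $P_\hbar$. *)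

theory Defs
  imports
    "HOL-Algebra.Algebra"
    "HOL-Library.Poly_Mapping"
    "HOL-Library.Numeral_Type"
    "HOL-Computational_Algebra.Polynomial"
begin

section \<open>Polynomial rings and free algebras as monoid algebras\<close>

text \<open>
  Finitely supported functions \<open>'m \<Rightarrow>\<^sub>0 'k\<close> on a monoid \<open>'m\<close>, with the convolution
  product of \<^theory>\<open>HOL-Library.Poly_Mapping\<close>, form the monoid algebra of \<open>'m\<close> over \<open>'k\<close>.
  The monoid of exponent vectors gives the commutative polynomial ring, the free monoid
  of words gives the free associative algebra.
\<close>

type_synonym ('n, 'k) polynom = "('n \<Rightarrow>\<^sub>0 nat) \<Rightarrow>\<^sub>0 'k"

datatype 'n word = Word (letters: "'n list")

instantiation word :: (type) monoid_add
begin

definition zero_word :: "'a word"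
  where "0 = Word []"

definition plus_word :: "'a word \<Rightarrow> 'a word \<Rightarrow> 'a word"
  where "u + v = Word (letters u @ letters v)"

instance
  by intro_classes (simp_all add: zero_word_def plus_word_def)

end

type_synonym ('n, 'k) free_alg = "'n word \<Rightarrow>\<^sub>0 'k"

definition scalar :: "'k \<Rightarrow> ('m::monoid_add \<Rightarrow>\<^sub>0 'k::field)"
  where "scalar a = Poly_Mapping.single 0 a"

definition monoid_algebra :: "('k, 'm::monoid_add \<Rightarrow>\<^sub>0 'k::field) module"
  where "monoid_algebra =
    \<lparr>carrier = UNIV, monoid.mult = (*), one = 1, ring.zero = 0, ring.add = (+), module.smult = (\<lambda>a p. scalar a * p)\<rparr>"

definition homogeneous :: "('m \<Rightarrow> nat) \<Rightarrow> nat \<Rightarrow> ('m \<Rightarrow>\<^sub>0 'k::zero) set"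
  where "homogeneous wt d = {p. \<forall>m \<in> Poly_Mapping.keys p. wt m = d}"

definition x_var :: "'n \<Rightarrow> ('n, 'k::field) polynom"
  where "x_var i = Poly_Mapping.single (Poly_Mapping.single i 1) 1"

definition poly_comp :: "nat \<Rightarrow> ('n::finite, 'k::field) polynom set"
  where "poly_comp = homogeneous (\<lambda>m. \<Sum>i\<in>UNIV. Poly_Mapping.lookup m i)"

definition y_var :: "'n \<Rightarrow> ('n, 'k::field) free_alg"
  where "y_var i = Poly_Mapping.single (Word [i]) 1"

definition free_comp :: "nat \<Rightarrow> ('n, 'k::field) free_alg set"
  where "free_comp = homogeneous (\<lambda>w. length (letters w))"


section \<open>Quadratic Poisson structures\<close>

locale poisson_bracket =
  fixes br :: "('n::finite, 'k::field) polynom \<Rightarrow> ('n, 'k) polynom \<Rightarrow> ('n, 'k) polynom"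
  assumes add_left: "br (p + q) r = br p r + br q r"
    and add_right: "br p (q + r) = br p q + br p r"
    and scalar_left: "br (scalar a * p) q = scalar a * br p q"
    and scalar_right: "br p (scalar a * q) = scalar a * br p q"
    and alternating: "br p p = 0"
    and jacobi: "br p (br q r) + br q (br r p) + br r (br p q) = 0"
    and leibniz: "br p (q * r) = q * br p r + br p q * r"

locale quadratic_poisson_bracket = poisson_bracket +
  assumes quadratic: "p \<in> poly_comp 1 \<Longrightarrow> q \<in> poly_comp 1 \<Longrightarrow> br p q \<in> poly_comp 2"


section \<open>The standard deformation quantization\<close>

definition quant_relations ::
    "('n \<Rightarrow> 'n \<Rightarrow> 'n \<Rightarrow> 'n \<Rightarrow> 'k) \<Rightarrow> 'k \<Rightarrow> ('n::finite, 'k::field) free_alg set"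
  where "quant_relations c h =
    {y_var i * y_var j - y_var j * y_var i
      - scalar (h / 2) *
          (\<Sum>k\<in>UNIV. \<Sum>l\<in>UNIV. scalar (c i j k l) * (y_var k * y_var l + y_var l * y_var k))
     | i j. True}"

text \<open>\<^const>\<open>ideal\<close> and hence \<^const>\<open>genideal\<close> are two-sided.\<close>

definition quant_ideal ::
    "('n \<Rightarrow> 'n \<Rightarrow> 'n \<Rightarrow> 'n \<Rightarrow> 'k) \<Rightarrow> 'k \<Rightarrow> ('n::finite, 'k::field) free_alg set"
  where "quant_ideal c h = Idl\<^bsub>monoid_algebra\<^esub> (quant_relations c h)"

definition quant_class ::
    "('n \<Rightarrow> 'n \<Rightarrow> 'n \<Rightarrow> 'n \<Rightarrow> 'k) \<Rightarrow> 'k \<Rightarrow> ('n::finite, 'k::field) free_alg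
      \<Rightarrow> ('n, 'k) free_alg set"
  where "quant_class c h p = quant_ideal c h +>\<^bsub>monoid_algebra\<^esub> p"

definition quantization ::
    "('n \<Rightarrow> 'n \<Rightarrow> 'n \<Rightarrow> 'n \<Rightarrow> 'k) \<Rightarrow> 'k \<Rightarrow> ('k, ('n::finite, 'k::field) free_alg set) module"
  where "quantization c h =
    (let Q = monoid_algebra Quot quant_ideal c h
     in \<lparr>carrier = carrier Q, monoid.mult = monoid.mult Q, one = one Q, ring.zero = ring.zero Q, ring.add = ring.add Q,
         module.smult = (\<lambda>a u. quant_class c h (scalar a) \<otimes>\<^bsub>Q\<^esub> u)\<rparr>)"

definition quant_comp ::
    "('n \<Rightarrow> 'n \<Rightarrow> 'n \<Rightarrow> 'n \<Rightarrow> 'k) \<Rightarrow> 'k \<Rightarrow> nat \<Rightarrow> ('n::finite, 'k::field) free_alg set set"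
  where "quant_comp c h d = quant_class c h ` free_comp d"


section \<open>Graded automorphism groups\<close>

text \<open>
  As in \<^const>\<open>AutoGroup\<close>, automorphisms are extensional functions on the carrier, composed
  as in \<^const>\<open>BijGroup\<close>. The argument \<open>A\<close> is any not necessarily commutative algebra with
  homogeneous components \<open>C d\<close>; the record type is borrowed from modules.
\<close>

definition graded_auts :: "('k, 'a) module \<Rightarrow> (nat \<Rightarrow> 'a set) \<Rightarrow> ('a \<Rightarrow> 'a) set"
  where "graded_auts A C =
    {f \<in> ring_hom A A \<inter> Bij (carrier A).
      (\<forall>a. \<forall>u \<in> carrier A. f (a \<odot>\<^bsub>A\<^esub> u) = a \<odot>\<^bsub>A\<^esub> f u) \<and> (\<forall>d. f ` C d = C d)}"

definition Aut_gr_quant ::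
    "('n \<Rightarrow> 'n \<Rightarrow> 'n \<Rightarrow> 'n \<Rightarrow> 'k) \<Rightarrow> 'k
      \<Rightarrow> (('n::finite, 'k::field) free_alg set \<Rightarrow> ('n, 'k) free_alg set) monoid"
  where "Aut_gr_quant c h =
    BijGroup (carrier (quantization c h))
      \<lparr>carrier := graded_auts (quantization c h) (quant_comp c h)\<rparr>"

definition PAut_gr ::
    "(('n::finite, 'k::field) polynom \<Rightarrow> ('n, 'k) polynom \<Rightarrow> ('n, 'k) polynom)
      \<Rightarrow> (('n, 'k) polynom \<Rightarrow> ('n, 'k) polynom) monoid"
  where "PAut_gr br =
    BijGroup UNIV
      \<lparr>carrier := {f \<in> graded_auts monoid_algebra poly_comp. \<forall>p q. f (br p q) = br (f p) (f q)}\<rparr>"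


section \<open>Both automorphism sets form groups\<close>

lemma ring_monoid_algebra: "ring (monoid_algebra :: ('k::field, 'm::monoid_add \<Rightarrow>\<^sub>0 'k) module)"
proof (rule ringI)
  show "abelian_group (monoid_algebra :: ('k, 'm \<Rightarrow>\<^sub>0 'k) module)"
  proof (rule abelian_groupI)
    fix x :: "'m \<Rightarrow>\<^sub>0 'k"
    show "\<exists>y\<in>carrier monoid_algebra. y \<oplus>\<^bsub>monoid_algebra\<^esub> x = \<zero>\<^bsub>monoid_algebra\<^esub>"
      by (rule bexI[of _ "- x"]) (simp_all add: monoid_algebra_def)
  qed (auto simp: monoid_algebra_def ac_simps)
  show "Group.monoid (monoid_algebra :: ('k, 'm \<Rightarrow>\<^sub>0 'k) module)"
    by (rule monoidI) (auto simp: monoid_algebra_def mult.assoc)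
qed (auto simp: monoid_algebra_def distrib_left distrib_right)

lemma ideal_quant_ideal: "ideal (quant_ideal c h) monoid_algebra"
  unfolding quant_ideal_def
  by (rule ring.genideal_ideal[OF ring_monoid_algebra]) (simp add: monoid_algebra_def)

lemma ring_quantization: "ring (quantization c h)"
proof -
  interpret Q: ring "monoid_algebra Quot quant_ideal c h"
    by (rule ideal.quotient_is_ring[OF ideal_quant_ideal])
  have sel: "carrier (quantization c h) = carrier (monoid_algebra Quot quant_ideal c h)"
    "monoid.mult (quantization c h) = monoid.mult (monoid_algebra Quot quant_ideal c h)"
    "one (quantization c h) = one (monoid_algebra Quot quant_ideal c h)"
    "ring.zero (quantization c h) = ring.zero (monoid_algebra Quot quant_ideal c h)"
    "ring.add (quantization c h) = ring.add (monoid_algebra Quot quant_ideal c h)"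
    by (simp_all add: quantization_def Let_def)
  show ?thesis
  proof (rule ringI)
    show "abelian_group (quantization c h)"
    proof (rule abelian_groupI)
      fix u assume "u \<in> carrier (quantization c h)"
      then show "\<exists>v\<in>carrier (quantization c h). v \<oplus>\<^bsub>quantization c h\<^esub> u = \<zero>\<^bsub>quantization c h\<^esub>"
        using Q.l_neg Q.a_inv_closed unfolding sel by blast
    qed (simp_all add: sel Q.a_ac)
    show "Group.monoid (quantization c h)"
      by (rule monoidI) (auto simp: sel Q.m_assoc)
  qed (auto simp: sel Q.l_distr Q.r_distr)
qed

lemma subgroup_graded_auts:
  fixes A :: "('k, 'a) module"
  assumes A: "ring A"
    and smult: "\<And>a u. u \<in> carrier A \<Longrightarrow> a \<odot>\<^bsub>A\<^esub> u \<in> carrier A"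
    and C: "\<And>d. C d \<subseteq> carrier A"
  shows "subgroup (graded_auts A C) (BijGroup (carrier A))"
proof (rule subgroup.intro)
  interpret ring A by (rule A)
  show "graded_auts A C \<subseteq> carrier (BijGroup (carrier A))"
    by (auto simp: graded_auts_def BijGroup_def)
  have "(\<lambda>x\<in>carrier A. x) ` C d = C d" for d
    using C[of d] by (auto simp: image_iff)
  then show "\<one>\<^bsub>BijGroup (carrier A)\<^esub> \<in> graded_auts A C"
    by (auto simp: graded_auts_def BijGroup_def id_Bij ring_hom_def smult)
  show "f \<otimes>\<^bsub>BijGroup (carrier A)\<^esub> g \<in> graded_auts A C"
    if f: "f \<in> graded_auts A C" and g: "g \<in> graded_auts A C" for f g
  proof -
    have "compose (carrier A) f g ` C d = C d" for d
    proof -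
      have "compose (carrier A) f g ` C d = f ` (g ` C d)"
        using C[of d] by (auto simp: compose_def image_iff subset_iff)
      then show ?thesis using f g by (simp add: graded_auts_def)
    qed
    moreover have "compose (carrier A) f g \<in> ring_hom A A"
      using f g by (auto simp: graded_auts_def ring_hom_def compose_def Pi_iff)
    moreover have "f \<in> Bij (carrier A)" "g \<in> Bij (carrier A)"
      using f g by (auto simp: graded_auts_def)
    moreover have "compose (carrier A) f g (a \<odot>\<^bsub>A\<^esub> u) = a \<odot>\<^bsub>A\<^esub> compose (carrier A) f g u"
      if "u \<in> carrier A" for a u
      using f g that smult by (auto simp: graded_auts_def compose_def ring_hom_def Pi_iff)
    ultimately show ?thesis
      by (simp add: graded_auts_def BijGroup_def compose_Bij)
  qed
  show "inv\<^bsub>BijGroup (carrier A)\<^esub> f \<in> graded_auts A C" if f: "f \<in> graded_auts A C" for f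
  proof -
    define g where "g = (\<lambda>x\<in>carrier A. inv_into (carrier A) f x)"
    have fB: "f \<in> Bij (carrier A)" and fh: "f \<in> ring_hom A A"
      and fs: "\<And>a u. u \<in> carrier A \<Longrightarrow> f (a \<odot>\<^bsub>A\<^esub> u) = a \<odot>\<^bsub>A\<^esub> f u"
      and fC: "\<And>d. f ` C d = C d"
      using f by (auto simp: graded_auts_def)
    have gB: "g \<in> Bij (carrier A)" unfolding g_def by (rule restrict_inv_into_Bij[OF fB])
    have bij: "bij_betw f (carrier A) (carrier A)" using fB by (simp add: Bij_def)
    have fcl: "f x \<in> carrier A" if "x \<in> carrier A" for x
      using bij that by (auto simp: bij_betw_def)
    have gcl: "g x \<in> carrier A" if "x \<in> carrier A" for x
      using gB that Bij_imp_funcset by fastforce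
    have gf: "g (f x) = x" if "x \<in> carrier A" for x
      using bij that fcl by (simp add: g_def bij_betw_inv_into_left)
    have fg: "f (g x) = x" if "x \<in> carrier A" for x
      using bij that by (simp add: g_def bij_betw_inv_into_right)
    have "g (x \<otimes>\<^bsub>A\<^esub> y) = g x \<otimes>\<^bsub>A\<^esub> g y" "g (x \<oplus>\<^bsub>A\<^esub> y) = g x \<oplus>\<^bsub>A\<^esub> g y"
      if xy: "x \<in> carrier A" "y \<in> carrier A" for x y
    proof -
      have "f (g x \<otimes>\<^bsub>A\<^esub> g y) = x \<otimes>\<^bsub>A\<^esub> y" "f (g x \<oplus>\<^bsub>A\<^esub> g y) = x \<oplus>\<^bsub>A\<^esub> y"
        using fh xy gcl fg by (auto simp: ring_hom_def)
      then show "g (x \<otimes>\<^bsub>A\<^esub> y) = g x \<otimes>\<^bsub>A\<^esub> g y" "g (x \<oplus>\<^bsub>A\<^esub> y) = g x \<oplus>\<^bsub>A\<^esub> g y"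
        using gf[of "g x \<otimes>\<^bsub>A\<^esub> g y"] gf[of "g x \<oplus>\<^bsub>A\<^esub> g y"] gcl xy by auto
    qed
    moreover have "g \<one>\<^bsub>A\<^esub> = \<one>\<^bsub>A\<^esub>"
      using gf[of "\<one>\<^bsub>A\<^esub>"] fh by (auto simp: ring_hom_def)
    ultimately have "g \<in> ring_hom A A" using gcl by (auto simp: ring_hom_def)
    moreover have "g (a \<odot>\<^bsub>A\<^esub> u) = a \<odot>\<^bsub>A\<^esub> g u" if "u \<in> carrier A" for a u
      using gf[of "a \<odot>\<^bsub>A\<^esub> g u"] fs[of "g u" a] fg gcl smult that by simp
    moreover have "g ` C d = C d" for d
    proof -
      have "g ` C d = g ` f ` C d" by (simp add: fC)
      also have "\<dots> = C d"
        unfolding image_image using gf C[of d] by (auto simp: subset_iff image_iff)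
      finally show ?thesis .
    qed
    ultimately show ?thesis
      using gB by (simp add: inv_BijGroup[OF fB] g_def[symmetric] graded_auts_def)
  qed
qed

lemma group_Aut_gr_quant: "group (Aut_gr_quant c h)"
proof -
  interpret R: ring "quantization c h" by (rule ring_quantization)
  have cls: "quant_class c h p \<in> carrier (quantization c h)" for p
    by (auto simp: quantization_def quant_class_def FactRing_def Let_def A_RCOSETS_def'
        monoid_algebra_def)
  have "subgroup (graded_auts (quantization c h) (quant_comp c h))
          (BijGroup (carrier (quantization c h)))"
  proof (rule subgroup_graded_auts[OF ring_quantization])
    fix a u assume "u \<in> carrier (quantization c h)"
    moreover have "a \<odot>\<^bsub>quantization c h\<^esub> u = quant_class c h (scalar a) \<otimes>\<^bsub>quantization c h\<^esub> u"
      by (simp add: quantization_def Let_def)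
    ultimately show "a \<odot>\<^bsub>quantization c h\<^esub> u \<in> carrier (quantization c h)"
      using cls by simp
  qed (auto simp: quant_comp_def cls)
  then show ?thesis
    unfolding Aut_gr_quant_def by (rule group.subgroup_imp_group[OF group_BijGroup])
qed

lemma group_PAut_gr:
  fixes br :: "('n::finite, 'k::field) polynom \<Rightarrow> ('n, 'k) polynom \<Rightarrow> ('n, 'k) polynom"
  shows "group (PAut_gr br)"
proof -
  let ?A = "monoid_algebra :: ('k, ('n, 'k) polynom) module"
  let ?G = "{f \<in> graded_auts ?A poly_comp. \<forall>p q. f (br p q) = br (f p) (f q)}"
  have U: "carrier ?A = UNIV" by (simp add: monoid_algebra_def)
  have sub: "subgroup (graded_auts ?A poly_comp) (BijGroup UNIV)"
    using subgroup_graded_auts[of ?A poly_comp, OF ring_monoid_algebra] by (simp add: U)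
  have "subgroup ?G (BijGroup UNIV)"
  proof (rule subgroup.intro)
    show "?G \<subseteq> carrier (BijGroup UNIV)" using subgroup.subset[OF sub] by blast
    show "\<one>\<^bsub>BijGroup UNIV\<^esub> \<in> ?G"
      using subgroup.one_closed[OF sub] by (simp add: BijGroup_def)
    show "f \<otimes>\<^bsub>BijGroup UNIV\<^esub> g \<in> ?G" if f: "f \<in> ?G" and g: "g \<in> ?G" for f g
    proof -
      have "f \<in> Bij UNIV" "g \<in> Bij UNIV" using f g by (auto simp: graded_auts_def U)
      then show ?thesis
        using subgroup.m_closed[OF sub, of f g] f g by (simp add: BijGroup_def compose_def)
    qed
    show "inv\<^bsub>BijGroup UNIV\<^esub> f \<in> ?G" if f: "f \<in> ?G" for f
    proof -
      have fB: "f \<in> Bij UNIV" using f by (auto simp: graded_auts_def U)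
      then have b: "bij f" by (simp add: Bij_def)
      have "inv_into UNIV f (br p q) = br (inv_into UNIV f p) (inv_into UNIV f q)" for p q
      proof -
        have "f (br (inv_into UNIV f p) (inv_into UNIV f q)) = br p q"
          using f b by (simp add: bij_is_surj surj_f_inv_f)
        then show ?thesis using b by (metis bij_inv_eq_iff)
      qed
      then show ?thesis
        using subgroup.m_inv_closed[OF sub, of f] f by (simp add: inv_BijGroup[OF fB])
    qed
  qed
  then show ?thesis
    unfolding PAut_gr_def by (rule group.subgroup_imp_group[OF group_BijGroup])
qed

end

theory Submission
  imports Defs
begin

text \<open>
  Both groups are groups of linear substitutions of the generators: the quantization \<open>P\<^sub>h\<close> and the
  polynomial ring \<open>P\<close> are generated in degree one, and the defining relations of \<open>P\<^sub>h\<close> have degree two,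
  so a graded automorphism on either side is determined by an invertible matrix acting on the space
  \<open>V\<close> of linear forms. It has to be seen that the same matrices occur on both sides, namely that a
  substitution preserves the bracket on \<open>V\<close> if and only if it maps the relations of \<open>P\<^sub>h\<close> into the
  ideal that they generate.

  Let \<open>\<sigma> : S\<^sup>2V \<rightarrow> V \<otimes> V\<close> be the symmetrization \<open>uv \<mapsto> u \<otimes> v + v \<otimes> u\<close>. The relations say precisely that
  \<open>u \<otimes> v - v \<otimes> u - (h/2) \<sigma>{u, v}\<close> vanishes in \<open>P\<^sub>h\<close>, for all linear forms \<open>u\<close> and \<open>v\<close> and not only for the
  generators (\<open>commutator_symmetrize_br\<close>). This description does not mention coordinates, so every
  bracket-preserving substitution induces an endomorphism of \<open>P\<^sub>h\<close>.

  The converse needs a handle on the ideal of relations in degree at most two. It is provided by the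
  linear map \<open>dequantize\<close> from the free algebra to \<open>P\<close> that takes \<open>u \<otimes> v\<close> to \<open>uv + (h/2){u, v}\<close>, is the
  identity on \<open>V\<close>, and vanishes in all other degrees. It kills the ideal (\<open>dequantize_ideal\<close>): the
  ideal is zero below degree two, in degree two it is spanned by the relations themselves, and those
  are killed because \<open>u \<otimes> v - v \<otimes> u\<close> goes to \<open>h{u, v}\<close>. Hence \<open>V\<close> embeds into \<open>P\<^sub>h\<close>, which makes the
  correspondence of substitutions injective. Moreover, when a substitution of linear forms \<open>u\<^sub>i\<close> for
  the generators preserves the ideal, applying \<open>dequantize\<close> to the image of a relation gives \<open>h\<close> times
  the difference of \<open>{u\<^sub>i, u\<^sub>j}\<close> and the image of \<open>{x\<^sub>i, x\<^sub>j}\<close> (\<open>dequantize_relator\<close>), so that the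
  substitution preserves the bracket.

  In this way the comparison takes place entirely in degrees one and two, where the ideal of
  relations is known explicitly.
\<close>


section \<open>Linear and multiplicative maps between monoid algebras\<close>

lemma monoid_algebra_induct [case_names zero single add]:
  fixes p :: "'m \<Rightarrow>\<^sub>0 'k::comm_monoid_add"
  assumes "P 0" and single: "\<And>m a. P (Poly_Mapping.single m a)"
    and add: "\<And>p q. P p \<Longrightarrow> P q \<Longrightarrow> P (p + q)"
  shows "P p"
proof (induction p rule: update_induct)
  case const
  show ?case by (rule \<open>P 0\<close>)
next
  case (update p m a)
  have "Poly_Mapping.update m a p = p + Poly_Mapping.single m a"
    using update.hyps
    by (intro poly_mapping_eqI) (auto simp: lookup_update lookup_add lookup_single in_keys_iff when_def)
  then show ?case using add[OF update.IH single] by simp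
qed

lemma scalar_commute: "scalar a * p = p * (scalar a :: 'm::monoid_add \<Rightarrow>\<^sub>0 'k::field)"
  by (induction p rule: monoid_algebra_induct)
    (simp_all add: scalar_def mult_single algebra_simps)

lemma mult_scalar_left: "p * (scalar a * q) = scalar a * (p * q :: 'm::monoid_add \<Rightarrow>\<^sub>0 'k::field)"
  using scalar_commute[of a p] by (simp flip: mult.assoc)

lemma scalar_add: "scalar (a + b) = (scalar a + scalar b :: 'm::monoid_add \<Rightarrow>\<^sub>0 'k::field)"
  and scalar_mult: "scalar (a * b) = (scalar a * scalar b :: 'm::monoid_add \<Rightarrow>\<^sub>0 'k::field)"
  and scalar_zero [simp]: "scalar 0 = (0 :: 'm::monoid_add \<Rightarrow>\<^sub>0 'k::field)"
  and scalar_one [simp]: "scalar 1 = (1 :: 'm::monoid_add \<Rightarrow>\<^sub>0 'k::field)"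
  by (simp_all add: scalar_def single_add mult_single)

lemma scalar_minus_one: "scalar (- 1) * p = - (p :: 'm::monoid_add \<Rightarrow>\<^sub>0 'k::field)"
  by (simp add: scalar_def single_uminus)

lemma scalar_times_single: "scalar a * Poly_Mapping.single m b = Poly_Mapping.single m (a * b :: 'k::field)"
  by (simp add: scalar_def mult_single)

lemma lookup_scalar_times:
  "Poly_Mapping.lookup (scalar a * p) m = (a :: 'k::field) * Poly_Mapping.lookup p m"
  by (induction p rule: monoid_algebra_induct)
    (simp_all add: scalar_times_single lookup_add lookup_single when_def distrib_left)

definition linear_map :: "(('m::monoid_add \<Rightarrow>\<^sub>0 'k::field) \<Rightarrow> ('l::monoid_add \<Rightarrow>\<^sub>0 'k)) \<Rightarrow> bool"
  where "linear_map F \<longleftrightarrow> (\<forall>p q. F (p + q) = F p + F q) \<and> (\<forall>a p. F (scalar a * p) = scalar a * F p)"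

definition algebra_map :: "(('m::monoid_add \<Rightarrow>\<^sub>0 'k::field) \<Rightarrow> ('l::monoid_add \<Rightarrow>\<^sub>0 'k)) \<Rightarrow> bool"
  where "algebra_map F \<longleftrightarrow> linear_map F \<and> F 1 = 1 \<and> (\<forall>p q. F (p * q) = F p * F q)"

lemma linear_map_add: "linear_map F \<Longrightarrow> F (p + q) = F p + F q"
  and linear_map_scalar: "linear_map F \<Longrightarrow> F (scalar a * p) = scalar a * F p"
  by (simp_all add: linear_map_def)

lemma linear_map_zero: "linear_map F \<Longrightarrow> F 0 = 0"
  using linear_map_scalar[of F 0 0] by simp

lemma linear_map_uminus: "linear_map F \<Longrightarrow> F (- p) = - F p"
  using linear_map_scalar[of F "- 1" p] by (simp add: scalar_minus_one)

lemma linear_map_diff: "linear_map F \<Longrightarrow> F (p - q) = F p - F q"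
  using linear_map_add[of F p "- q"] by (simp add: linear_map_uminus)

lemma linear_map_sum: "linear_map F \<Longrightarrow> F (\<Sum>i\<in>A. p i) = (\<Sum>i\<in>A. F (p i))"
  by (induction A rule: infinite_finite_induct) (simp_all add: linear_map_zero linear_map_add)

lemmas linear_map_simps =
  linear_map_add linear_map_scalar linear_map_zero linear_map_uminus linear_map_diff linear_map_sum

lemma algebra_map_linear: "algebra_map F \<Longrightarrow> linear_map F"
  and algebra_map_one: "algebra_map F \<Longrightarrow> F 1 = 1"
  and algebra_map_mult: "algebra_map F \<Longrightarrow> F (p * q) = F p * F q"
  by (simp_all add: algebra_map_def)

lemma algebra_map_scalar: "algebra_map F \<Longrightarrow> F (scalar a) = scalar a"
  using linear_map_scalar[of F a 1] by (simp add: algebra_map_def)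

lemmas algebra_map_simps = algebra_map_one algebra_map_mult algebra_map_scalar
  linear_map_simps[OF algebra_map_linear]

lemma algebra_map_compose: "algebra_map F \<Longrightarrow> algebra_map G \<Longrightarrow> algebra_map (\<lambda>p. F (G p))"
  and algebra_map_id: "algebra_map (\<lambda>p. p)"
  by (simp_all add: algebra_map_simps algebra_map_def[of "\<lambda>p. F (G p)"] linear_map_def[of "\<lambda>p. F (G p)"])
    (simp add: algebra_map_def linear_map_def)

definition linear_extension ::
    "('m \<Rightarrow> ('l::monoid_add \<Rightarrow>\<^sub>0 'k::field)) \<Rightarrow> ('m \<Rightarrow>\<^sub>0 'k) \<Rightarrow> ('l \<Rightarrow>\<^sub>0 'k)"
  where "linear_extension \<phi> p =
    (\<Sum>m\<in>Poly_Mapping.keys p. scalar (Poly_Mapping.lookup p m) * \<phi> m)"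

lemma linear_extension_superset:
  assumes "finite A" "Poly_Mapping.keys p \<subseteq> A"
  shows "linear_extension \<phi> p = (\<Sum>m\<in>A. scalar (Poly_Mapping.lookup p m) * \<phi> m)"
  unfolding linear_extension_def
  by (rule sum.mono_neutral_left) (use assms in \<open>auto simp: in_keys_iff\<close>)

lemma linear_extension_linear:
  "linear_map (linear_extension \<phi> :: ('m::monoid_add \<Rightarrow>\<^sub>0 'k::field) \<Rightarrow> ('l::monoid_add \<Rightarrow>\<^sub>0 'k))"
proof -
  have "linear_extension \<phi> (p + q) = linear_extension \<phi> p + linear_extension \<phi> q"
    for p q :: "'m \<Rightarrow>\<^sub>0 'k"
  proof -
    let ?A = "Poly_Mapping.keys p \<union> Poly_Mapping.keys q"
    have "Poly_Mapping.keys (p + q) \<subseteq> ?A" by (rule keys_add)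
    then show ?thesis
      by (simp add: linear_extension_superset[of ?A] lookup_add scalar_add distrib_right sum.distrib)
  qed
  moreover have "linear_extension \<phi> (scalar a * p) = scalar a * linear_extension \<phi> p"
    for a and p :: "'m \<Rightarrow>\<^sub>0 'k"
  proof -
    have "Poly_Mapping.keys (scalar a * p) \<subseteq> Poly_Mapping.keys p"
      by (auto simp: in_keys_iff lookup_scalar_times)
    then show ?thesis
      by (simp add: linear_extension_superset[of "Poly_Mapping.keys p"] lookup_scalar_times
          scalar_mult sum_distrib_left mult.assoc)
  qed
  ultimately show ?thesis by (simp add: linear_map_def)
qed

lemma linear_extension_single [simp]:
  "linear_extension \<phi> (Poly_Mapping.single m a) = scalar a * \<phi> m"
  by (subst linear_extension_superset[of "{m}"]) simp_all

text \<open>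
  The image of \<open>\<phi>\<close> may be noncommutative; multiplicativity on monomials suffices because scalars
  are central (\<open>scalar_commute\<close>).
\<close>

lemma linear_extension_algebra_map:
  fixes \<phi> :: "'m::monoid_add \<Rightarrow> ('l::monoid_add \<Rightarrow>\<^sub>0 'k::field)"
  assumes zero: "\<phi> 0 = 1" and plus: "\<And>m n. \<phi> (m + n) = \<phi> m * \<phi> n"
  shows "algebra_map (linear_extension \<phi>)"
proof -
  note L = linear_map_add[OF linear_extension_linear] linear_map_zero[OF linear_extension_linear]
  have single: "linear_extension \<phi> (Poly_Mapping.single m a * q)
      = linear_extension \<phi> (Poly_Mapping.single m a) * linear_extension \<phi> q" for m a q
  proof (induction q rule: monoid_algebra_induct)
    case (single n b)
    have "scalar a * (scalar b * (\<phi> m * \<phi> n)) = scalar a * (scalar b * \<phi> m) * \<phi> n"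
      by (simp add: mult.assoc)
    also have "\<dots> = scalar a * \<phi> m * (scalar b * \<phi> n)"
      unfolding scalar_commute[of b "\<phi> m"] by (simp add: mult.assoc)
    finally show ?case
      by (simp add: mult_single scalar_mult plus mult.assoc)
  qed (simp_all add: L distrib_left)
  have "linear_extension \<phi> (p * q) = linear_extension \<phi> p * linear_extension \<phi> q" for p q
    by (induction p rule: monoid_algebra_induct) (simp_all add: single L distrib_right)
  moreover have "linear_extension \<phi> 1 = 1"
    using linear_extension_single[of \<phi> 0 1] by (simp add: zero)
  ultimately show ?thesis by (simp add: algebra_map_def linear_extension_linear)
qed

definition free_hom :: "('n \<Rightarrow> ('l::monoid_add \<Rightarrow>\<^sub>0 'k::field)) \<Rightarrow> ('n, 'k) free_alg \<Rightarrow> ('l \<Rightarrow>\<^sub>0 'k)"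
  where "free_hom v = linear_extension (\<lambda>w. prod_list (map v (letters w)))"

definition poly_hom :: "('n::finite \<Rightarrow> ('l::comm_monoid_add \<Rightarrow>\<^sub>0 'k::field)) \<Rightarrow> ('n, 'k) polynom \<Rightarrow> ('l \<Rightarrow>\<^sub>0 'k)"
  where "poly_hom v = linear_extension (\<lambda>m. \<Prod>i\<in>UNIV. v i ^ Poly_Mapping.lookup m i)"

lemma algebra_map_free_hom: "algebra_map (free_hom v)"
  unfolding free_hom_def
  by (rule linear_extension_algebra_map) (simp_all add: zero_word_def plus_word_def)

lemma free_hom_y_var [simp]: "free_hom v (y_var i) = v i"
  by (simp add: free_hom_def y_var_def)

lemma algebra_map_poly_hom: "algebra_map (poly_hom v)"
  unfolding poly_hom_def
  by (rule linear_extension_algebra_map) (simp_all add: lookup_add power_add prod.distrib)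

lemma poly_hom_x_var [simp]: "poly_hom v (x_var i) = v i"
proof -
  have "(\<Prod>j\<in>UNIV. v j ^ Poly_Mapping.lookup (Poly_Mapping.single i 1) j) = (\<Prod>j\<in>UNIV. if j = i then v j else 1)"
    by (rule prod.cong) (auto simp: lookup_single when_def)
  then show ?thesis by (simp add: poly_hom_def x_var_def)
qed

text \<open>
  Closure under addition and multiplication is what makes statements about algebra maps and about
  derivations provable by checking scalars and generators only.
\<close>

lemma free_alg_induct [case_names scalar var add mult]:
  fixes p :: "('n, 'k::field) free_alg"
  assumes scalar: "\<And>a. P (scalar a)" and var: "\<And>i. P (y_var i)"
    and add: "\<And>p q. P p \<Longrightarrow> P q \<Longrightarrow> P (p + q)" and mult: "\<And>p q. P p \<Longrightarrow> P q \<Longrightarrow> P (p * q)"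
  shows "P p"
proof (induction p rule: monoid_algebra_induct)
  case zero
  show ?case using scalar[of 0] by simp
next
  case (single w a)
  have "P (Poly_Mapping.single (Word is) 1)" for "is"
  proof (induction "is")
    case Nil
    show ?case using scalar[of 1] by (simp add: scalar_def zero_word_def)
  next
    case (Cons i "is")
    have "Poly_Mapping.single (Word (i # is)) 1 = (y_var i * Poly_Mapping.single (Word is) 1 :: ('n, 'k) free_alg)"
      by (simp add: y_var_def mult_single plus_word_def)
    then show ?case using mult[OF var Cons.IH] by simp
  qed
  then have "P (scalar a * Poly_Mapping.single (Word (letters w)) 1)" by (intro mult scalar)
  then show ?case by (simp add: scalar_times_single)
qed (rule add)

lemma polynom_induct [case_names scalar var add mult]:
  fixes p :: "('n, 'k::field) polynom"
  assumes scalar: "\<And>a. P (scalar a)" and var: "\<And>i. P (x_var i)"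
    and add: "\<And>p q. P p \<Longrightarrow> P q \<Longrightarrow> P (p + q)" and mult: "\<And>p q. P p \<Longrightarrow> P q \<Longrightarrow> P (p * q)"
  shows "P p"
proof (induction p rule: monoid_algebra_induct)
  case zero
  show ?case using scalar[of 0] by simp
next
  case (single m a)
  have "P (Poly_Mapping.single m 1)"
  proof (induction m rule: monoid_algebra_induct)
    case zero
    show ?case using scalar[of 1] by simp
  next
    case (single i d)
    show ?case
    proof (induction d)
      case 0
      show ?case using scalar[of 1] by simp
    next
      case (Suc d)
      have "Poly_Mapping.single (Poly_Mapping.single i (Suc d)) 1
          = (x_var i * Poly_Mapping.single (Poly_Mapping.single i d) 1 :: ('n, 'k) polynom)"
        by (simp add: x_var_def mult_single flip: single_add)
      then show ?case using mult[OF var Suc.IH] by simp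
    qed
  next
    case (add m n)
    then show ?case using mult[OF add] by (simp add: mult_single)
  qed
  then have "P (scalar a * Poly_Mapping.single m 1)" by (intro mult scalar)
  then show ?case by (simp add: scalar_times_single)
qed (rule add)

lemma free_algebra_map_eqI:
  assumes "algebra_map F" "algebra_map G" and "\<And>i. F (y_var i) = G (y_var i)"
  shows "F p = G p"
  by (induction p rule: free_alg_induct) (simp_all add: assms algebra_map_simps)

lemma poly_algebra_map_eqI:
  fixes F G :: "('n::finite, 'k::field) polynom \<Rightarrow> ('l::monoid_add \<Rightarrow>\<^sub>0 'k)"
  assumes "algebra_map F" "algebra_map G" and "\<And>i. F (x_var i) = G (x_var i)"
  shows "F p = G p"
  by (induction p rule: polynom_induct) (simp_all add: assms algebra_map_simps)


section \<open>Homogeneous components\<close>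

lemma homogeneous_zero: "0 \<in> homogeneous wt d"
  by (simp add: homogeneous_def)

lemma homogeneous_add: "p \<in> homogeneous wt d \<Longrightarrow> q \<in> homogeneous wt d \<Longrightarrow> p + q \<in> homogeneous wt d"
  using keys_add[of p q] by (auto simp: homogeneous_def)

lemma homogeneous_scalar: "p \<in> homogeneous wt d \<Longrightarrow> scalar a * p \<in> homogeneous wt d"
  for a :: "'k::field"
  by (auto simp: homogeneous_def in_keys_iff lookup_scalar_times)

lemma homogeneous_sum: "(\<And>i. i \<in> A \<Longrightarrow> p i \<in> homogeneous wt d) \<Longrightarrow> (\<Sum>i\<in>A. p i) \<in> homogeneous wt d"
  by (induction A rule: infinite_finite_induct) (simp_all add: homogeneous_zero homogeneous_add)

lemma homogeneous_mult:
  fixes p q :: "'m::monoid_add \<Rightarrow>\<^sub>0 'k::field"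
  assumes wt: "\<And>m n. wt (m + n) = wt m + wt n"
    and "p \<in> homogeneous wt d" "q \<in> homogeneous wt e"
  shows "p * q \<in> homogeneous wt (d + e)"
  using keys_mult[of p q] assms by (auto simp: homogeneous_def)

lemma linear_extension_homogeneous:
  assumes "\<And>m. \<phi> m \<in> homogeneous wt' (wt m)" and "p \<in> homogeneous wt d"
  shows "linear_extension \<phi> p \<in> homogeneous wt' d"
  unfolding linear_extension_def
  by (intro homogeneous_sum homogeneous_scalar) (use assms in \<open>fastforce simp: homogeneous_def\<close>)

lemma free_comp_mult: "p \<in> free_comp d \<Longrightarrow> q \<in> free_comp e \<Longrightarrow> p * q \<in> free_comp (d + e)"
  unfolding free_comp_def by (rule homogeneous_mult) (simp_all add: plus_word_def)

lemma poly_comp_mult: "p \<in> poly_comp d \<Longrightarrow> q \<in> poly_comp e \<Longrightarrow> p * q \<in> poly_comp (d + e)"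
  unfolding poly_comp_def by (rule homogeneous_mult) (simp_all add: lookup_add sum.distrib)

lemma free_comp_one: "1 \<in> free_comp 0"
  by (simp add: free_comp_def homogeneous_def zero_word_def)

lemma poly_comp_one: "1 \<in> poly_comp 0"
  by (simp add: poly_comp_def homogeneous_def)

lemma y_var_comp: "y_var i \<in> free_comp 1"
  by (simp add: y_var_def free_comp_def homogeneous_def)

lemma sum_lookup_single: "(\<Sum>j\<in>UNIV. Poly_Mapping.lookup (Poly_Mapping.single i d) (j::'n::finite)) = (d::nat)"
  by (simp add: lookup_single when_def)

lemma x_var_comp: "x_var i \<in> poly_comp 1"
  by (simp add: x_var_def poly_comp_def homogeneous_def sum_lookup_single)

lemma free_hom_comp:
  assumes v: "\<And>i. v i \<in> free_comp 1" and p: "p \<in> free_comp d"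
  shows "free_hom v p \<in> free_comp d"
proof -
  have "prod_list (map v is) \<in> free_comp (length is)" for "is"
    by (induction "is") (use free_comp_mult[OF v] free_comp_one in force)+
  then show ?thesis
    using p unfolding free_hom_def free_comp_def by (intro linear_extension_homogeneous) auto
qed

lemma poly_hom_comp:
  assumes v: "\<And>i. v i \<in> poly_comp 1" and p: "p \<in> poly_comp d"
  shows "poly_hom v p \<in> poly_comp d"
proof -
  have pow: "v i ^ k \<in> poly_comp k" for i k
    by (induction k) (use poly_comp_mult[OF v] poly_comp_one in force)+
  have "(\<Prod>i\<in>A. v i ^ e i) \<in> poly_comp (\<Sum>i\<in>A. e i)" for A and e :: "'a \<Rightarrow> nat"
    by (induction A rule: infinite_finite_induct) (simp_all add: poly_comp_one poly_comp_mult pow)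
  then show ?thesis
    using p unfolding poly_hom_def poly_comp_def by (intro linear_extension_homogeneous) auto
qed

lemma free_comp_1_expansion:
  fixes p :: "('n::finite, 'k::field) free_alg"
  assumes "p \<in> free_comp 1"
  shows "p = (\<Sum>j\<in>UNIV. scalar (Poly_Mapping.lookup p (Word [j])) * y_var j)"
proof (rule poly_mapping_eqI)
  fix w
  have z: "Poly_Mapping.lookup p w = 0" if "length (letters w) \<noteq> 1"
    using assms that by (auto simp: free_comp_def homogeneous_def in_keys_iff)
  show "Poly_Mapping.lookup p w
      = Poly_Mapping.lookup (\<Sum>j\<in>UNIV. scalar (Poly_Mapping.lookup p (Word [j])) * y_var j) w"
  proof (cases "\<exists>j. w = Word [j]")
    case True
    then obtain j where w: "w = Word [j]" by blast
    show ?thesis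
      by (simp add: w lookup_sum lookup_scalar_times y_var_def lookup_single when_def if_distrib cong: if_cong)
  next
    case False
    then have w: "Word [j] \<noteq> w" for j by blast
    with False have "length (letters w) \<noteq> 1" by (cases w) (auto simp: length_Suc_conv)
    from w z[OF this] show ?thesis
      by (simp add: lookup_sum lookup_scalar_times y_var_def lookup_single when_def)
  qed
qed

text \<open>
  A monomial of total degree one is a single variable, so the coordinates of a linear form are its
  coefficients at the variables.
\<close>

lemma poly_comp_1_expansion:
  fixes p :: "('n::finite, 'k::field) polynom"
  assumes "p \<in> poly_comp 1"
  shows "p = (\<Sum>j\<in>UNIV. scalar (Poly_Mapping.lookup p (Poly_Mapping.single j 1)) * x_var j)"
proof (rule poly_mapping_eqI)
  fix m :: "'n \<Rightarrow>\<^sub>0 nat"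
  have z: "Poly_Mapping.lookup p m = 0" if "(\<Sum>i\<in>UNIV. Poly_Mapping.lookup m i) \<noteq> 1"
    using assms that by (auto simp: poly_comp_def homogeneous_def in_keys_iff)
  show "Poly_Mapping.lookup p m
      = Poly_Mapping.lookup (\<Sum>j\<in>UNIV. scalar (Poly_Mapping.lookup p (Poly_Mapping.single j 1)) * x_var j) m"
  proof (cases "\<exists>j. m = Poly_Mapping.single j 1")
    case True
    then obtain j where m: "m = Poly_Mapping.single j 1" by blast
    have "Poly_Mapping.single i (1::nat) = Poly_Mapping.single j 1 \<longleftrightarrow> i = j" for i
      by (metis lookup_single_eq lookup_single_not_eq one_neq_zero)
    then show ?thesis
      by (simp add: m lookup_sum lookup_scalar_times x_var_def lookup_single[of "Poly_Mapping.single _ _"] when_def if_distrib cong: if_cong)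
  next
    case False
    then have m: "Poly_Mapping.single j 1 \<noteq> m" for j by blast
    have "(\<Sum>i\<in>UNIV. Poly_Mapping.lookup m i) \<noteq> 1"
    proof
      assume s: "(\<Sum>i\<in>UNIV. Poly_Mapping.lookup m i) = 1"
      then obtain i where i: "Poly_Mapping.lookup m i = 1" "\<forall>j. i \<noteq> j \<longrightarrow> Poly_Mapping.lookup m j = 0"
        by (auto simp: sum_eq_Suc0_iff)
      then have "m = Poly_Mapping.single i 1"
        by (intro poly_mapping_eqI) (auto simp: lookup_single when_def)
      then show False using m by blast
    qed
    from m z[OF this] show ?thesis
      by (simp add: lookup_sum lookup_scalar_times x_var_def lookup_single[of "Poly_Mapping.single _ _"] when_def
          del: One_nat_def)
  qed
qed

lemma poly_comp_1_induct [consumes 1, case_names zero var scalar add]: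
  fixes p :: "('n::finite, 'k::field) polynom"
  assumes "p \<in> poly_comp 1" and zero: "P 0" and var: "\<And>i. P (x_var i)"
    and scalar: "\<And>a p. P p \<Longrightarrow> P (scalar a * p)" and add: "\<And>p q. P p \<Longrightarrow> P q \<Longrightarrow> P (p + q)"
  shows "P p"
proof -
  have "P (\<Sum>j\<in>A. scalar (b j) * x_var j)" for A and b :: "'n \<Rightarrow> 'k"
    by (induction A rule: infinite_finite_induct) (simp_all add: zero add scalar var)
  then show ?thesis by (subst poly_comp_1_expansion[OF assms(1)])
qed


section \<open>The quantization as a quotient\<close>

lemma ideal_monoid_algebraI:
  fixes J :: "('m::monoid_add \<Rightarrow>\<^sub>0 'k::field) set"
  assumes zero: "0 \<in> J" and add: "\<And>p q. p \<in> J \<Longrightarrow> q \<in> J \<Longrightarrow> p + q \<in> J"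
    and left: "\<And>a p. p \<in> J \<Longrightarrow> a * p \<in> J" and right: "\<And>a p. p \<in> J \<Longrightarrow> p * a \<in> J"
  shows "ideal J monoid_algebra"
proof (rule idealI[OF ring_monoid_algebra])
  interpret R: ring "monoid_algebra :: ('k, 'm \<Rightarrow>\<^sub>0 'k) module" by (rule ring_monoid_algebra)
  have inv: "inv\<^bsub>add_monoid monoid_algebra\<^esub> p = - p" for p :: "'m \<Rightarrow>\<^sub>0 'k"
    by (rule group.inv_equality[OF R.a_group]) (simp_all add: monoid_algebra_def)
  have "- p \<in> J" if "p \<in> J" for p
    using left[OF that, of "- 1"] by simp
  then show "subgroup J (add_monoid monoid_algebra)"
  proof (intro group.subgroupI[OF R.a_group])
    show "J \<noteq> {}" using zero by blast
  qed (use add in \<open>auto simp: inv\<close>, auto simp: monoid_algebra_def)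
qed (use left right in \<open>auto simp: monoid_algebra_def\<close>)

text \<open>
  The defining relation of the quantization with arbitrary elements in place of the generators:
  algebra maps carry relators to relators, so the image of a relation under a substitution is
  again of this shape.
\<close>

definition quant_relator ::
    "('n \<Rightarrow> 'n \<Rightarrow> 'n \<Rightarrow> 'n \<Rightarrow> 'k) \<Rightarrow> 'k \<Rightarrow> ('n \<Rightarrow> ('m \<Rightarrow>\<^sub>0 'k)) \<Rightarrow> 'n \<Rightarrow> 'n::finite
      \<Rightarrow> ('m::monoid_add \<Rightarrow>\<^sub>0 'k::field)"
  where "quant_relator c h v i j = v i * v j - v j * v i
    - scalar (h / 2) * (\<Sum>k\<in>UNIV. \<Sum>l\<in>UNIV. scalar (c i j k l) * (v k * v l + v l * v k))"

lemma quant_relations_eq: "quant_relations c h = {quant_relator c h y_var i j | i j. True}"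
  by (simp add: quant_relations_def quant_relator_def)

lemma algebra_map_quant_relator:
  "algebra_map F \<Longrightarrow> F (quant_relator c h v i j) = quant_relator c h (\<lambda>i. F (v i)) i j"
  by (simp add: quant_relator_def algebra_map_simps)

lemma quant_relator_in_ideal: "quant_relator c h y_var i j \<in> quant_ideal c h"
proof -
  have "quant_relations c h \<subseteq> quant_ideal c h"
    unfolding quant_ideal_def
    by (rule ring.genideal_self[OF ring_monoid_algebra]) (simp add: monoid_algebra_def)
  then show ?thesis by (auto simp: quant_relations_eq)
qed

lemma quant_ideal_minimal:
  assumes "ideal J monoid_algebra" and "\<And>i j. quant_relator c h y_var i j \<in> J"
  shows "quant_ideal c h \<subseteq> J"
  unfolding quant_ideal_def
  by (rule ring.genideal_minimal[OF ring_monoid_algebra assms(1)])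
    (use assms(2) in \<open>auto simp: quant_relations_eq\<close>)

lemma quant_ideal_zero: "0 \<in> quant_ideal c h"
  and quant_ideal_add: "p \<in> quant_ideal c h \<Longrightarrow> q \<in> quant_ideal c h \<Longrightarrow> p + q \<in> quant_ideal c h"
  and quant_ideal_left: "p \<in> quant_ideal c h \<Longrightarrow> a * p \<in> quant_ideal c h"
  and quant_ideal_right: "p \<in> quant_ideal c h \<Longrightarrow> p * a \<in> quant_ideal c h"
proof -
  interpret ideal "quant_ideal c h" monoid_algebra by (rule ideal_quant_ideal)
  show "0 \<in> quant_ideal c h" using a_subgroup[THEN subgroup.one_closed] by (simp add: monoid_algebra_def)
  show "p + q \<in> quant_ideal c h" if "p \<in> quant_ideal c h" "q \<in> quant_ideal c h"
    using a_subgroup[THEN subgroup.m_closed, OF that] by (simp add: monoid_algebra_def)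
  show "a * p \<in> quant_ideal c h" "p * a \<in> quant_ideal c h" if "p \<in> quant_ideal c h"
    using I_l_closed[OF that, of a] I_r_closed[OF that, of a] by (simp_all add: monoid_algebra_def)
qed

lemma quant_ideal_uminus: "p \<in> quant_ideal c h \<Longrightarrow> - p \<in> quant_ideal c h"
  using quant_ideal_left[of p c h "- 1"] by simp

lemma quant_class_eq: "quant_class c h p = (\<lambda>x. x + p) ` quant_ideal c h"
  by (auto simp: quant_class_def a_r_coset_def' monoid_algebra_def)

lemma quant_class_eq_iff: "quant_class c h p = quant_class c h q \<longleftrightarrow> p - q \<in> quant_ideal c h"
proof
  assume "quant_class c h p = quant_class c h q"
  moreover have "p \<in> quant_class c h p"
    unfolding quant_class_eq using quant_ideal_zero by (force intro: rev_image_eqI)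
  ultimately show "p - q \<in> quant_ideal c h" by (auto simp: quant_class_eq)
next
  assume pq: "p - q \<in> quant_ideal c h"
  have "quant_class c h p \<subseteq> quant_class c h q" if "p - q \<in> quant_ideal c h" for p q
  proof
    fix z assume "z \<in> quant_class c h p"
    then obtain x where "x \<in> quant_ideal c h" "z = x + p" by (auto simp: quant_class_eq)
    then have "z = (x + (p - q)) + q" "x + (p - q) \<in> quant_ideal c h"
      using that by (simp_all add: quant_ideal_add)
    then show "z \<in> quant_class c h q" unfolding quant_class_eq by blast
  qed
  moreover have "q - p \<in> quant_ideal c h" using quant_ideal_uminus[OF pq] by simp
  ultimately show "quant_class c h p = quant_class c h q" using pq by blast
qed

lemma carrier_quantization: "carrier (quantization c h) = range (quant_class c h)"
  by (auto simp: quantization_def quant_class_def FactRing_def Let_def A_RCOSETS_def' monoid_algebra_def)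

lemma quant_class_closed [simp]: "quant_class c h p \<in> carrier (quantization c h)"
  by (simp add: carrier_quantization)

lemma quant_class_mult:
    "quant_class c h p \<otimes>\<^bsub>quantization c h\<^esub> quant_class c h q = quant_class c h (p * q)"
  and quant_class_add:
    "quant_class c h p \<oplus>\<^bsub>quantization c h\<^esub> quant_class c h q = quant_class c h (p + q)"
  and quant_class_one: "\<one>\<^bsub>quantization c h\<^esub> = quant_class c h 1"
proof -
  interpret ideal "quant_ideal c h" monoid_algebra by (rule ideal_quant_ideal)
  have *: "p \<in> carrier monoid_algebra" "q \<in> carrier monoid_algebra" by (simp_all add: monoid_algebra_def)
  show "quant_class c h p \<otimes>\<^bsub>quantization c h\<^esub> quant_class c h q = quant_class c h (p * q)"
    using rcoset_mult_add[OF *]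
    by (simp add: quantization_def Let_def FactRing_def quant_class_def) (simp add: monoid_algebra_def)
  show "quant_class c h p \<oplus>\<^bsub>quantization c h\<^esub> quant_class c h q = quant_class c h (p + q)"
    using a_rcos_sum[OF *]
    by (simp add: quantization_def Let_def FactRing_def quant_class_def) (simp add: monoid_algebra_def)
  show "\<one>\<^bsub>quantization c h\<^esub> = quant_class c h 1"
    by (simp add: quantization_def Let_def FactRing_def quant_class_def) (simp add: monoid_algebra_def)
qed

lemma quant_class_smult: "a \<odot>\<^bsub>quantization c h\<^esub> quant_class c h p = quant_class c h (scalar a * p)"
proof -
  have "a \<odot>\<^bsub>quantization c h\<^esub> quant_class c h p
      = quant_class c h (scalar a) \<otimes>\<^bsub>quantization c h\<^esub> quant_class c h p"
    by (simp add: quantization_def Let_def)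
  then show ?thesis by (simp add: quant_class_mult)
qed

text \<open>
  The map of the quotient induced by \<open>F\<close>. It is made extensional because automorphisms are
  extensional functions on the carrier; the choice of representative is harmless as soon as \<open>F\<close>
  preserves the ideal (\<open>quant_map_class\<close>).
\<close>

definition quant_map ::
    "('n \<Rightarrow> 'n \<Rightarrow> 'n \<Rightarrow> 'n \<Rightarrow> 'k) \<Rightarrow> 'k \<Rightarrow> (('n, 'k) free_alg \<Rightarrow> ('n, 'k) free_alg)
      \<Rightarrow> ('n::finite, 'k::field) free_alg set \<Rightarrow> ('n, 'k) free_alg set"
  where "quant_map c h F = (\<lambda>u\<in>carrier (quantization c h). quant_class c h (F (SOME p. quant_class c h p = u)))"

lemma quant_map_class:
  assumes F: "algebra_map F" and I: "\<And>p. p \<in> quant_ideal c h \<Longrightarrow> F p \<in> quant_ideal c h"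
  shows "quant_map c h F (quant_class c h p) = quant_class c h (F p)"
proof -
  let ?q = "SOME q. quant_class c h q = quant_class c h p"
  have "quant_class c h ?q = quant_class c h p" by (rule someI) simp
  then have "F (?q - p) \<in> quant_ideal c h" by (intro I) (simp add: quant_class_eq_iff)
  then have "quant_class c h (F ?q) = quant_class c h (F p)"
    by (simp add: quant_class_eq_iff algebra_map_simps[OF F])
  then show ?thesis by (simp add: quant_map_def)
qed

lemma algebra_map_preserves_quant_ideal:
  fixes F :: "('n::finite, 'k::field) free_alg \<Rightarrow> ('n, 'k) free_alg"
  assumes F: "algebra_map F" and rel: "\<And>i j. F (quant_relator c h y_var i j) \<in> quant_ideal c h"
    and p: "p \<in> quant_ideal c h"
  shows "F p \<in> quant_ideal c h"
proof -
  have "ideal {p. F p \<in> quant_ideal c h} monoid_algebra"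
    by (rule ideal_monoid_algebraI)
      (simp_all add: algebra_map_simps[OF F] quant_ideal_zero quant_ideal_add quant_ideal_left quant_ideal_right)
  from quant_ideal_minimal[OF this] show ?thesis using rel p by blast
qed


section \<open>Linear forms and symmetrization\<close>

text \<open>
  The identification of the linear forms of the polynomial ring with those of the free algebra,
  extended by zero to the other degrees.
\<close>

definition linear_lift :: "('n::finite, 'k::field) polynom \<Rightarrow> ('n, 'k) free_alg"
  where "linear_lift p = (\<Sum>j\<in>UNIV. scalar (Poly_Mapping.lookup p (Poly_Mapping.single j 1)) * y_var j)"

lemma linear_map_linear_lift: "linear_map linear_lift"
  by (simp add: linear_map_def linear_lift_def lookup_add lookup_scalar_times scalar_add scalar_mult
      distrib_right sum.distrib sum_distrib_left mult.assoc)

lemmas linear_lift_simps = linear_map_simps[OF linear_map_linear_lift]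

lemma single_1_eq_iff: "Poly_Mapping.single i (1::nat) = Poly_Mapping.single j 1 \<longleftrightarrow> i = j"
  by (metis lookup_single_eq lookup_single_not_eq one_neq_zero)

lemma linear_lift_x_var [simp]: "linear_lift (x_var i) = y_var i"
proof -
  have "linear_lift (x_var i) = (\<Sum>j\<in>UNIV. if j = i then y_var j else 0)"
    unfolding linear_lift_def
    by (rule sum.cong) (auto simp: x_var_def lookup_single[of "Poly_Mapping.single _ _"] when_def single_1_eq_iff
        simp del: One_nat_def)
  then show ?thesis by simp
qed

lemma linear_lift_comp: "linear_lift p \<in> free_comp 1"
  using y_var_comp unfolding linear_lift_def free_comp_def by (intro homogeneous_sum homogeneous_scalar)

text \<open>
  The map \<open>uv \<mapsto> u \<otimes> v + v \<otimes> u\<close> on quadratic forms. In terms of coefficients, a mixed monomial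
  \<open>x\<^sub>k x\<^sub>l\<close> contributes at both \<open>(k, l)\<close> and \<open>(l, k)\<close>, while \<open>x\<^sub>k\<^sup>2\<close> contributes only at \<open>(k, k)\<close>, hence
  with the factor two.
\<close>

definition symmetrize :: "('n::finite, 'k::field) polynom \<Rightarrow> ('n, 'k) free_alg"
  where "symmetrize p = (\<Sum>k\<in>UNIV. \<Sum>l\<in>UNIV.
    scalar ((if k = l then 2 else 1) * Poly_Mapping.lookup p (Poly_Mapping.single k 1 + Poly_Mapping.single l 1))
      * (y_var k * y_var l))"

lemma linear_map_symmetrize: "linear_map symmetrize"
  by (simp add: linear_map_def symmetrize_def lookup_add lookup_scalar_times scalar_add scalar_mult
      distrib_right distrib_left sum.distrib sum_distrib_left mult.assoc mult.left_commute)

lemmas symmetrize_simps = linear_map_simps[OF linear_map_symmetrize]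

lemma single_plus_single_eq_iff:
  "Poly_Mapping.single a (1::nat) + Poly_Mapping.single b 1 = Poly_Mapping.single k 1 + Poly_Mapping.single l 1
    \<longleftrightarrow> (k = a \<and> l = b) \<or> (k = b \<and> l = a)" (is "?L = ?R \<longleftrightarrow> _")
proof
  assume eq: "?L = ?R"
  have "Poly_Mapping.lookup ?L j = Poly_Mapping.lookup ?R j" for j by (simp only: eq)
  from this[of a] this[of b] this[of k] this[of l] show "(k = a \<and> l = b) \<or> (k = b \<and> l = a)"
    by (auto simp: lookup_add lookup_single when_def split: if_splits)
qed (auto simp: add.commute)

lemma symmetrize_vars:
  fixes a b :: "'n::finite"
  shows "symmetrize (x_var a * x_var b) = (y_var a * y_var b + y_var b * y_var a :: ('n, 'k::field) free_alg)"
proof -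
  let ?d = "\<lambda>a b k l. if k = a then if l = b then 1 else 0 else (0::'k)"
  have coeff: "(if k = l then 2 else 1) * Poly_Mapping.lookup (x_var a * x_var b :: ('n, 'k) polynom)
      (Poly_Mapping.single k 1 + Poly_Mapping.single l 1) = ?d a b k l + ?d b a k l" for k l
    by (auto simp: x_var_def mult_single lookup_single[of "_ + _"] when_def single_plus_single_eq_iff
        simp del: One_nat_def)
  have delta: "(\<Sum>k\<in>UNIV. \<Sum>l\<in>UNIV. scalar (?d a b k l) * (y_var k * y_var l)) = (y_var a * y_var b :: ('n, 'k) free_alg)"
    for a b :: 'n
  proof -
    have "(\<Sum>l\<in>UNIV. scalar (?d a b k l) * (y_var k * y_var l))
        = (if k = a then y_var k * y_var b else 0 :: ('n, 'k) free_alg)" for k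
    proof -
      have "(\<Sum>l\<in>UNIV. scalar (?d a b k l) * (y_var k * y_var l))
          = (\<Sum>l\<in>UNIV. if l = b then if k = a then y_var k * y_var l else 0 else 0 :: ('n, 'k) free_alg)"
        by (rule sum.cong) auto
      then show ?thesis by simp
    qed
    then show ?thesis by simp
  qed
  show ?thesis
    unfolding symmetrize_def coeff by (simp only: scalar_add distrib_right sum.distrib delta)
qed

text \<open>
  Identities between bilinear expressions in two linear forms, possibly modulo a subspace \<open>J\<close>,
  need only be checked on the variables. With \<open>J = {0}\<close> this gives equations, with the ideal of
  relations it gives congruences.
\<close>

lemma bilinear_on_linear_forms:
  fixes B :: "('n::finite, 'k::field) polynom \<Rightarrow> ('n, 'k) polynom \<Rightarrow> ('m::monoid_add \<Rightarrow>\<^sub>0 'k)"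
  assumes linear: "\<And>v. linear_map (\<lambda>u. B u v)" "\<And>u. linear_map (B u)"
    and J: "0 \<in> J" "\<And>p q. p \<in> J \<Longrightarrow> q \<in> J \<Longrightarrow> p + q \<in> J" "\<And>a p. p \<in> J \<Longrightarrow> scalar a * p \<in> J"
    and vars: "\<And>i j. B (x_var i) (x_var j) \<in> J"
    and u: "u \<in> poly_comp 1" and v: "v \<in> poly_comp 1"
  shows "B u v \<in> J"
proof -
  note simps = linear_map_simps[OF linear(1)] linear_map_simps[OF linear(2)]
  have "B (x_var i) v \<in> J" for i
    using v by (induction v rule: poly_comp_1_induct) (simp_all add: simps J vars)
  with u show ?thesis
    by (induction u rule: poly_comp_1_induct) (simp_all add: simps J)
qed

lemma symmetrize_mult:
  fixes u v :: "('n::finite, 'k::field) polynom"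
  assumes "u \<in> poly_comp 1" "v \<in> poly_comp 1"
  shows "symmetrize (u * v) = linear_lift u * linear_lift v + linear_lift v * linear_lift u"
proof -
  let ?B = "\<lambda>u v. symmetrize (u * v) - (linear_lift u * linear_lift v + linear_lift v * linear_lift u)"
  have "linear_map (\<lambda>u. ?B u v)" "linear_map (?B u)" for u v :: "('n, 'k) polynom"
    by (simp_all add: linear_map_def linear_lift_simps symmetrize_simps distrib_left distrib_right
        right_diff_distrib mult_scalar_left[of "linear_lift _"] mult_scalar_left[of u] mult.assoc)
  then have "?B u v \<in> {0}"
    by (rule bilinear_on_linear_forms[where B = ?B, OF _ _ _ _ _ _ assms]) (simp_all add: symmetrize_vars)
  then show ?thesis by simp
qed


section \<open>Comparing the bracket with the relations\<close>

locale quantized_bracket = poisson_bracket br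
  for br :: "('n::finite, 'k::field) polynom \<Rightarrow> ('n, 'k) polynom \<Rightarrow> ('n, 'k) polynom" +
  fixes c :: "'n \<Rightarrow> 'n \<Rightarrow> 'n \<Rightarrow> 'n \<Rightarrow> 'k" and h :: 'k
  assumes br_vars: "\<And>i j. br (x_var i) (x_var j)
      = (\<Sum>k\<in>UNIV. \<Sum>l\<in>UNIV. scalar (c i j k l) * (x_var k * x_var l))"
    and h_nonzero: "h \<noteq> 0" and two_nonzero: "(2::'k) \<noteq> 0"
begin

lemma linear_map_br_left: "linear_map (\<lambda>p. br p q)"
  and linear_map_br_right: "linear_map (br p)"
  by (simp_all add: linear_map_def add_left add_right scalar_left scalar_right)

lemmas br_linear = linear_map_simps[OF linear_map_br_left] linear_map_simps[OF linear_map_br_right]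

lemma br_antisym: "br p q = - br q p"
proof -
  have "br (p + q) (p + q) = br p p + br q p + (br p q + br q q)" by (simp only: add_left add_right)
  then have "br p q + br q p = 0" by (simp add: alternating add.commute)
  then show ?thesis by (rule eq_neg_iff_add_eq_0[THEN iffD2])
qed

lemma br_one: "br p 1 = 0"
  using leibniz[of p 1 1] by simp

lemma br_scalar: "br p (scalar a) = 0"
  using scalar_right[of p a 1] by (simp add: br_one)

text \<open>
  A coordinate-free form of the relations: for variables \<open>u\<close> and \<open>v\<close> this is a defining relation,
  and the expression is bilinear in \<open>u\<close> and \<open>v\<close>.
\<close>

lemma commutator_symmetrize_br:
  assumes "u \<in> poly_comp 1" "v \<in> poly_comp 1"
  shows "linear_lift u * linear_lift v - linear_lift v * linear_lift u - scalar (h / 2) * symmetrize (br u v)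
    \<in> quant_ideal c h" (is "?K u v \<in> _")
proof (rule bilinear_on_linear_forms[where B = ?K])
  show "linear_map (\<lambda>u. ?K u v)" "linear_map (?K u)" for u v
    by (simp_all add: linear_map_def linear_lift_simps symmetrize_simps br_linear distrib_left distrib_right
        right_diff_distrib mult_scalar_left[of "linear_lift _"] mult_scalar_left[of "scalar (h / 2)"] mult.assoc)
  show "?K (x_var i) (x_var j) \<in> quant_ideal c h" for i j
  proof -
    have "symmetrize (br (x_var i) (x_var j))
        = (\<Sum>k\<in>UNIV. \<Sum>l\<in>UNIV. scalar (c i j k l) * (y_var k * y_var l + y_var l * y_var k))"
      by (simp add: br_vars symmetrize_simps symmetrize_vars)
    then show ?thesis
      using quant_relator_in_ideal[of c h i j] by (simp add: quant_relator_def)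
  qed
qed (use assms in \<open>simp_all add: quant_ideal_zero quant_ideal_add quant_ideal_left\<close>)

text \<open>
  In degree two this is a first-order star product, \<open>u \<otimes> v \<mapsto> uv + (h/2){u, v}\<close>. All higher degrees
  are cut off, which costs nothing because only the linear and quadratic parts of the ideal of
  relations are to be detected.
\<close>

definition dequantize :: "('n, 'k) free_alg \<Rightarrow> ('n, 'k) polynom"
  where "dequantize = linear_extension (\<lambda>w. case letters w of
      [i] \<Rightarrow> x_var i
    | [i, j] \<Rightarrow> x_var i * x_var j + scalar (h / 2) * br (x_var i) (x_var j)
    | _ \<Rightarrow> 0)"

lemma linear_map_dequantize: "linear_map dequantize"
  by (simp add: dequantize_def linear_extension_linear)

lemmas dequantize_linear = linear_map_simps[OF linear_map_dequantize]

lemma dequantize_var [simp]: "dequantize (y_var i) = x_var i"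
  and dequantize_vars:
    "dequantize (y_var i * y_var j) = x_var i * x_var j + scalar (h / 2) * br (x_var i) (x_var j)"
  by (simp_all add: dequantize_def y_var_def mult_single plus_word_def)

lemma dequantize_high_degree:
  assumes "p \<in> free_comp d" "d > 2"
  shows "dequantize p = 0"
  unfolding dequantize_def linear_extension_def
proof (intro sum.neutral ballI)
  fix w assume "w \<in> Poly_Mapping.keys p"
  then have "length (letters w) > 2" using assms by (auto simp: free_comp_def homogeneous_def)
  then show "scalar (Poly_Mapping.lookup p w) * (case letters w of
      [i] \<Rightarrow> x_var i
    | [i, j] \<Rightarrow> x_var i * x_var j + scalar (h / 2) * br (x_var i) (x_var j)
    | _ \<Rightarrow> 0) = 0"
    by (auto split: list.split)
qed

lemma dequantize_linear_lift: "u \<in> poly_comp 1 \<Longrightarrow> dequantize (linear_lift u) = u"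
  by (induction u rule: poly_comp_1_induct)
    (simp_all add: linear_lift_simps dequantize_linear)

lemma dequantize_comp_1:
  assumes "v \<in> free_comp 1"
  shows "dequantize v \<in> poly_comp 1" and "linear_lift (dequantize v) = v"
proof -
  note v = free_comp_1_expansion[OF assms]
  have D: "dequantize v = (\<Sum>j\<in>UNIV. scalar (Poly_Mapping.lookup v (Word [j])) * x_var j)"
    by (subst v) (simp add: dequantize_linear)
  show "dequantize v \<in> poly_comp 1"
    using x_var_comp unfolding D poly_comp_def by (intro homogeneous_sum homogeneous_scalar)
  show "linear_lift (dequantize v) = v"
    unfolding D by (subst (2) v) (simp add: linear_lift_simps)
qed

lemma dequantize_mult:
  assumes "u \<in> poly_comp 1" "v \<in> poly_comp 1"
  shows "dequantize (linear_lift u * linear_lift v) = u * v + scalar (h / 2) * br u v"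
proof -
  let ?B = "\<lambda>u v. dequantize (linear_lift u * linear_lift v) - (u * v + scalar (h / 2) * br u v)"
  have "linear_map (\<lambda>u. ?B u v)" "linear_map (?B u)" for u v
    by (simp_all add: linear_map_def linear_lift_simps dequantize_linear br_linear distrib_left distrib_right
        right_diff_distrib mult_scalar_left[of "linear_lift _"] mult_scalar_left[of u]
        mult_scalar_left[of "scalar (h / 2)"] mult.assoc)
  then have "?B u v \<in> {0}"
    by (rule bilinear_on_linear_forms[where B = ?B, OF _ _ _ _ _ _ assms]) (simp_all add: dequantize_vars)
  then show ?thesis by simp
qed

text \<open>
  The antisymmetric part of the relator contributes \<open>h{u\<^sub>i, u\<^sub>j}\<close>. In the symmetric part the bracket
  terms cancel, each \<open>u\<^sub>k u\<^sub>l\<close> occurs twice, and the factor \<open>h/2\<close> becomes \<open>h\<close>.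
\<close>

lemma dequantize_relator:
  assumes u: "\<And>i. u i \<in> poly_comp 1"
  shows "dequantize (quant_relator c h (\<lambda>i. linear_lift (u i)) i j)
    = scalar h * (br (u i) (u j) - (\<Sum>k\<in>UNIV. \<Sum>l\<in>UNIV. scalar (c i j k l) * (u k * u l)))"
proof -
  let ?S = "\<Sum>k\<in>UNIV. \<Sum>l\<in>UNIV. scalar (c i j k l) * (u k * u l)"
  have h: "scalar h = scalar (h / 2) + (scalar (h / 2) :: ('n, 'k) polynom)"
  proof -
    have "h / 2 + h / 2 = h" using two_nonzero by (simp flip: mult_2)
    then show ?thesis by (simp flip: scalar_add)
  qed
  have sym: "dequantize (linear_lift (u k) * linear_lift (u l)) + dequantize (linear_lift (u l) * linear_lift (u k))
      = u k * u l + u k * u l" for k l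
    using br_antisym[of "u l" "u k"] by (simp add: dequantize_mult[OF u u] mult.commute)
  have comm: "dequantize (linear_lift (u i) * linear_lift (u j)) - dequantize (linear_lift (u j) * linear_lift (u i))
      = scalar h * br (u i) (u j)"
    using br_antisym[of "u j" "u i"] by (simp add: dequantize_mult[OF u u] h algebra_simps)
  have "dequantize (quant_relator c h (\<lambda>i. linear_lift (u i)) i j)
      = scalar h * br (u i) (u j) - scalar (h / 2) * (?S + ?S)"
    by (simp only: quant_relator_def dequantize_linear comm sym) (simp only: distrib_left sum.distrib)
  also have "\<dots> = scalar h * (br (u i) (u j) - ?S)"
    by (simp add: h algebra_simps)
  finally show ?thesis .
qed

text \<open>
  The elements all of whose multiples on both sides are killed form an ideal. The relations lie in
  it: a multiple by monomials either is by scalars, and the relation itself is killed, or lives in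
  degree greater than two.
\<close>

lemma dequantize_ideal:
  assumes "p \<in> quant_ideal c h"
  shows "dequantize p = 0"
proof -
  \<comment> \<open>the largest ideal inside the kernel, which itself is not an ideal\<close>
  let ?J = "{p. \<forall>a b. dequantize (a * p * b) = 0}"
  have "ideal ?J monoid_algebra"
  proof (rule ideal_monoid_algebraI)
    show "a * p \<in> ?J" "p * a \<in> ?J" if "p \<in> ?J" for a p
      using that by (simp_all flip: mult.assoc) (simp add: mult.assoc)
  qed (simp_all add: distrib_left distrib_right dequantize_linear)
  moreover have "quant_relator c h y_var i j \<in> ?J" for i j
  proof -
    let ?r = "quant_relator c h y_var i j :: ('n, 'k) free_alg"
    have r0: "dequantize ?r = 0"
      using dequantize_relator[of x_var i j, OF x_var_comp] by (simp add: br_vars)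
    have r2: "?r \<in> free_comp 2"
    proof -
      have yy: "y_var k * y_var l \<in> free_comp 2" for k l
        using free_comp_mult[OF y_var_comp y_var_comp, of k l] by (simp add: numeral_2_eq_2)
      have "p - q = p + scalar (- 1) * q" for p q :: "('n, 'k) free_alg" by (simp add: scalar_minus_one)
      then show ?thesis unfolding quant_relator_def free_comp_def
        by (simp only:) (intro homogeneous_add homogeneous_scalar homogeneous_sum yy[unfolded free_comp_def])
    qed
    have "dequantize (a * ?r * b) = 0" for a b
    proof (induction a rule: monoid_algebra_induct)
      case (single v \<alpha>)
      show ?case
      proof (induction b rule: monoid_algebra_induct)
        case (single w \<beta>)
        show ?case
        proof (cases "v = 0 \<and> w = 0")
          case True
          then have "Poly_Mapping.single v \<alpha> * ?r * Poly_Mapping.single w \<beta> = scalar \<alpha> * (scalar \<beta> * ?r)"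
            using scalar_commute[of \<beta> ?r] by (simp add: scalar_def mult.assoc)
          then show ?thesis by (simp add: dequantize_linear r0)
        next
          case False
          have "Poly_Mapping.single x \<gamma> \<in> free_comp (length (letters x))" for x and \<gamma> :: 'k
            by (simp add: free_comp_def homogeneous_def)
          then have "Poly_Mapping.single v \<alpha> * ?r * Poly_Mapping.single w \<beta>
              \<in> free_comp (length (letters v) + 2 + length (letters w))"
            by (intro free_comp_mult r2)
          moreover have "length (letters v) + 2 + length (letters w) > 2"
            using False by (cases v; cases w) (auto simp: zero_word_def)
          ultimately show ?thesis by (rule dequantize_high_degree)
        qed
      qed (simp_all add: distrib_left dequantize_linear)
    qed (simp_all add: distrib_right dequantize_linear)
    then show ?thesis by simp
  qed
  ultimately have "quant_ideal c h \<subseteq> ?J" by (rule quant_ideal_minimal)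
  then have "dequantize (1 * p * 1) = 0" using assms by blast
  then show ?thesis by simp
qed

end


section \<open>Automorphisms of graded algebras\<close>

lemma graded_autsI:
  assumes f: "f \<in> ring_hom A A" "f \<in> extensional (carrier A)"
    and smult: "\<And>a u. u \<in> carrier A \<Longrightarrow> f (a \<odot>\<^bsub>A\<^esub> u) = a \<odot>\<^bsub>A\<^esub> f u"
    and g: "\<And>u. u \<in> carrier A \<Longrightarrow> g u \<in> carrier A"
    and inverse: "\<And>u. u \<in> carrier A \<Longrightarrow> f (g u) = u" "\<And>u. u \<in> carrier A \<Longrightarrow> g (f u) = u"
    and C: "\<And>d. C d \<subseteq> carrier A" "\<And>d u. u \<in> C d \<Longrightarrow> f u \<in> C d" "\<And>d u. u \<in> C d \<Longrightarrow> g u \<in> C d"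
  shows "f \<in> graded_auts A C"
proof -
  have "f u \<in> carrier A" if "u \<in> carrier A" for u
    using f(1) that by (auto simp: ring_hom_def)
  then have "bij_betw f (carrier A) (carrier A)"
    using g inverse by (intro bij_betw_byWitness[of _ g]) auto
  moreover have "f ` C d = C d" for d
  proof
    show "C d \<subseteq> f ` C d"
    proof
      fix u assume u: "u \<in> C d"
      then have "f (g u) = u" using C(1) inverse(1) by blast
      with C(3)[OF u] show "u \<in> f ` C d" by (metis imageI)
    qed
  qed (use C in auto)
  ultimately show ?thesis using f smult by (simp add: graded_auts_def Bij_def)
qed

lemma BijGroup_subgroup_inverse:
  assumes grp: "group (BijGroup S\<lparr>carrier := H\<rparr>)" and H: "H \<subseteq> Bij S" and f: "f \<in> H"
  obtains g where "g \<in> H" "\<And>x. x \<in> S \<Longrightarrow> f (g x) = x" "\<And>x. x \<in> S \<Longrightarrow> g (f x) = x"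
proof -
  interpret group "BijGroup S\<lparr>carrier := H\<rparr>" by (rule grp)
  let ?g = "inv\<^bsub>BijGroup S\<lparr>carrier := H\<rparr>\<^esub> f"
  have g: "?g \<in> H" using inv_closed f by simp
  have "compose S f ?g = (\<lambda>x\<in>S. x)" "compose S ?g f = (\<lambda>x\<in>S. x)"
    using r_inv[of f] l_inv[of f] f g H by (auto simp: BijGroup_def subset_iff)
  then have "f (?g x) = x" "?g (f x) = x" if "x \<in> S" for x
    using that by (metis compose_eq restrict_apply')+
  then show ?thesis using that g by blast
qed

lemma PAut_gr_inverse:
  assumes "f \<in> carrier (PAut_gr br)"
  obtains g where "g \<in> carrier (PAut_gr br)" "\<And>p. f (g p) = p" "\<And>p. g (f p) = p"
proof -
  let ?H = "carrier (PAut_gr br)"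
  have "PAut_gr br = BijGroup UNIV\<lparr>carrier := ?H\<rparr>" by (simp add: PAut_gr_def)
  then have "group (BijGroup UNIV\<lparr>carrier := ?H\<rparr>)" using group_PAut_gr[of br] by simp
  moreover have "?H \<subseteq> Bij UNIV" by (auto simp: PAut_gr_def graded_auts_def monoid_algebra_def)
  ultimately show ?thesis by (rule BijGroup_subgroup_inverse[OF _ _ assms]) (use that in auto)
qed

lemma Aut_gr_quant_inverse:
  assumes "\<phi> \<in> carrier (Aut_gr_quant c h)"
  obtains \<psi> where "\<psi> \<in> carrier (Aut_gr_quant c h)"
    "\<And>p. \<phi> (\<psi> (quant_class c h p)) = quant_class c h p" "\<And>p. \<psi> (\<phi> (quant_class c h p)) = quant_class c h p"
proof -
  let ?H = "carrier (Aut_gr_quant c h)" and ?S = "carrier (quantization c h)"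
  have "Aut_gr_quant c h = BijGroup ?S\<lparr>carrier := ?H\<rparr>" by (simp add: Aut_gr_quant_def)
  then have "group (BijGroup ?S\<lparr>carrier := ?H\<rparr>)" using group_Aut_gr_quant[of c h] by simp
  moreover have "?H \<subseteq> Bij ?S" by (auto simp: Aut_gr_quant_def graded_auts_def)
  ultimately show ?thesis
    by (rule BijGroup_subgroup_inverse[OF _ _ assms]) (use that in auto)
qed

lemma PAut_gr_iff:
  "f \<in> carrier (PAut_gr br) \<longleftrightarrow>
    algebra_map f \<and> bij f \<and> (\<forall>d. f ` poly_comp d = poly_comp d) \<and> (\<forall>p q. f (br p q) = br (f p) (f q))"
  by (auto simp: PAut_gr_def graded_auts_def monoid_algebra_def ring_hom_def Bij_def
      algebra_map_def linear_map_def)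

lemma PAut_gr_mult:
  assumes "f \<in> carrier (PAut_gr br)" "g \<in> carrier (PAut_gr br)"
  shows "f \<otimes>\<^bsub>PAut_gr br\<^esub> g = (\<lambda>p. f (g p))"
proof -
  have "f \<in> Bij UNIV" "g \<in> Bij UNIV" using assms by (auto simp: PAut_gr_def graded_auts_def monoid_algebra_def)
  then show ?thesis by (auto simp: PAut_gr_def BijGroup_def compose_def)
qed

lemma Aut_gr_quant_mult:
  assumes "\<phi> \<in> carrier (Aut_gr_quant c h)" "\<psi> \<in> carrier (Aut_gr_quant c h)"
  shows "\<phi> \<otimes>\<^bsub>Aut_gr_quant c h\<^esub> \<psi> = compose (carrier (quantization c h)) \<phi> \<psi>"
proof -
  have "\<phi> \<in> Bij (carrier (quantization c h))" "\<psi> \<in> Bij (carrier (quantization c h))"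
    using assms by (auto simp: Aut_gr_quant_def graded_auts_def)
  then show ?thesis by (simp add: Aut_gr_quant_def BijGroup_def)
qed

lemma quant_map_graded_aut:
  fixes F G :: "('n::finite, 'k::field) free_alg \<Rightarrow> ('n, 'k) free_alg"
  assumes F: "algebra_map F" "\<And>p. p \<in> quant_ideal c h \<Longrightarrow> F p \<in> quant_ideal c h"
      "\<And>d p. p \<in> free_comp d \<Longrightarrow> F p \<in> free_comp d"
    and G: "algebra_map G" "\<And>p. p \<in> quant_ideal c h \<Longrightarrow> G p \<in> quant_ideal c h"
      "\<And>d p. p \<in> free_comp d \<Longrightarrow> G p \<in> free_comp d"
    and inverse: "\<And>p. F (G p) = p" "\<And>p. G (F p) = p"
  shows "quant_map c h F \<in> carrier (Aut_gr_quant c h)"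
proof -
  note Fc = quant_map_class[OF F(1,2)] and Gc = quant_map_class[OF G(1,2)]
  have "quant_map c h F \<in> graded_auts (quantization c h) (quant_comp c h)"
  proof (rule graded_autsI[of _ _ "quant_map c h G"])
    show "quant_map c h F \<in> ring_hom (quantization c h) (quantization c h)"
      by (rule ring_hom_memI)
        (auto simp: carrier_quantization quant_class_mult quant_class_add quant_class_one Fc algebra_map_simps[OF F(1)])
    show "quant_map c h F \<in> extensional (carrier (quantization c h))"
      by (simp add: quant_map_def)
  qed (use F(3) G(3) in \<open>auto simp: carrier_quantization quant_comp_def quant_class_smult Fc Gc
      algebra_map_simps[OF F(1)] inverse\<close>)
  then show ?thesis by (simp add: Aut_gr_quant_def)
qed

text \<open>
  The image of each generator has a linear representative, since the automorphism preserves
  degree one. Substituting these representatives lifts the automorphism to the free algebra.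
\<close>

lemma Aut_gr_quant_lift:
  fixes c :: "'n \<Rightarrow> 'n \<Rightarrow> 'n \<Rightarrow> 'n::finite \<Rightarrow> 'k::field"
  assumes "\<phi> \<in> carrier (Aut_gr_quant c h)"
  obtains v where "\<And>i. v i \<in> free_comp 1"
    and "\<And>p. \<phi> (quant_class c h p) = quant_class c h (free_hom v p)"
    and "\<And>p. p \<in> quant_ideal c h \<Longrightarrow> free_hom v p \<in> quant_ideal c h"
proof -
  let ?Q = "quantization c h"
  have hom: "\<phi> \<in> ring_hom ?Q ?Q" and smult: "\<And>a u. u \<in> carrier ?Q \<Longrightarrow> \<phi> (a \<odot>\<^bsub>?Q\<^esub> u) = a \<odot>\<^bsub>?Q\<^esub> \<phi> u"
    and comp: "\<phi> ` quant_comp c h 1 = quant_comp c h 1"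
    using assms by (auto simp: Aut_gr_quant_def graded_auts_def)
  have "\<phi> (quant_class c h (y_var i)) \<in> quant_comp c h 1" for i
    using comp y_var_comp[of i] unfolding quant_comp_def by blast
  then have "\<exists>p. p \<in> free_comp 1 \<and> \<phi> (quant_class c h (y_var i)) = quant_class c h p" for i
    by (auto simp: quant_comp_def)
  then obtain v where v: "\<And>i. v i \<in> free_comp 1"
      "\<And>i. \<phi> (quant_class c h (y_var i)) = quant_class c h (v i)"
    by metis
  note F = algebra_map_simps[OF algebra_map_free_hom[of v]]
  have cls: "\<phi> (quant_class c h p) = quant_class c h (free_hom v p)" for p
  proof (induction p rule: free_alg_induct)
    case (scalar a)
    have "\<phi> (quant_class c h (scalar a * 1)) = quant_class c h (scalar a * 1)"
      using smult[of "quant_class c h 1" a] ring_hom_one[OF hom]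
      by (simp only: quant_class_smult quant_class_one quant_class_closed)
    then show ?case by (simp add: F)
  next
    case (add p q)
    then show ?case
      using ring_hom_add[OF hom, of "quant_class c h p" "quant_class c h q"] by (simp add: F quant_class_add)
  next
    case (mult p q)
    then show ?case
      using ring_hom_mult[OF hom, of "quant_class c h p" "quant_class c h q"] by (simp add: F quant_class_mult)
  qed (simp add: v)
  moreover have "free_hom v p \<in> quant_ideal c h" if "p \<in> quant_ideal c h" for p
  proof -
    have "quant_class c h p = quant_class c h 0" using that by (simp add: quant_class_eq_iff)
    then have "quant_class c h (free_hom v p) = quant_class c h (free_hom v 0)" by (simp flip: cls)
    then show ?thesis by (simp add: quant_class_eq_iff F)
  qed
  ultimately show ?thesis by (rule that[OF v(1)])
qed


section \<open>The isomorphism\<close>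

text \<open>
  The linear substitution by which \<open>f\<close> acts on the variables, carried out in the free algebra.
\<close>

definition free_lift ::
    "(('n, 'k) polynom \<Rightarrow> ('n, 'k) polynom) \<Rightarrow> ('n::finite, 'k::field) free_alg \<Rightarrow> ('n, 'k) free_alg"
  where "free_lift f = free_hom (\<lambda>i. linear_lift (f (x_var i)))"

lemma algebra_map_free_lift: "algebra_map (free_lift f)"
  by (simp add: free_lift_def algebra_map_free_hom)

lemma free_lift_comp: "p \<in> free_comp d \<Longrightarrow> free_lift f p \<in> free_comp d"
  unfolding free_lift_def by (intro free_hom_comp linear_lift_comp)

lemma free_lift_linear_lift:
  assumes "algebra_map f" "u \<in> poly_comp 1"
  shows "free_lift f (linear_lift u) = linear_lift (f u)"
  using assms(2)
  by (induction u rule: poly_comp_1_induct)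
    (simp_all add: linear_lift_simps algebra_map_simps[OF algebra_map_free_lift]
      algebra_map_simps[OF assms(1)], simp_all add: free_lift_def)

lemma free_lift_compose:
  assumes "algebra_map f" "\<And>i. g (x_var i) \<in> poly_comp 1"
  shows "free_lift (\<lambda>p. f (g p)) p = free_lift f (free_lift g p)"
proof (rule free_algebra_map_eqI[where G = "\<lambda>p. free_lift f (free_lift g p)"])
  fix i
  have "free_lift f (free_lift g (y_var i)) = free_lift f (linear_lift (g (x_var i)))"
    by (simp add: free_lift_def)
  also have "\<dots> = linear_lift (f (g (x_var i)))" using assms by (rule free_lift_linear_lift)
  finally show "free_lift (\<lambda>p. f (g p)) (y_var i) = free_lift f (free_lift g (y_var i))"
    by (simp add: free_lift_def)
qed (rule algebra_map_free_lift, rule algebra_map_compose[OF algebra_map_free_lift algebra_map_free_lift])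

lemma free_lift_id: "free_lift (\<lambda>p. p) p = p"
  by (rule free_algebra_map_eqI[OF algebra_map_free_lift algebra_map_id]) (simp add: free_lift_def)

context quantized_bracket
begin

text \<open>
  By the Leibniz rule in each argument; the left argument is reduced to the right one by
  antisymmetry.
\<close>

lemma algebra_map_preserves_br:
  assumes f: "algebra_map f" and vars: "\<And>i j. f (br (x_var i) (x_var j)) = br (f (x_var i)) (f (x_var j))"
  shows "f (br p q) = br (f p) (f q)"
proof -
  note fs = algebra_map_simps[OF f]
  have step: "f (br r p) = br (f r) (f p)" if "\<And>j. f (br r (x_var j)) = br (f r) (f (x_var j))" for r p
    by (induction p rule: polynom_induct) (simp_all add: that fs br_scalar leibniz add_right)
  have "f (br (x_var i) p) = br (f (x_var i)) (f p)" for i p by (rule step) (rule vars)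
  then have "f (br p (x_var i)) = br (f p) (f (x_var i))" for p i
    using br_antisym[of p "x_var i"] br_antisym[of "f p" "f (x_var i)"] by (simp add: fs)
  then show ?thesis by (rule step)
qed

lemma PAut_gr_var_comp:
  assumes "f \<in> carrier (PAut_gr br)"
  shows "f (x_var i) \<in> poly_comp 1"
  using assms x_var_comp[of i] unfolding PAut_gr_iff by blast

text \<open>
  If the bracket is preserved, the image of the relation for \<open>x\<^sub>i\<close> and \<open>x\<^sub>j\<close> is the coordinate-free
  relation for \<open>f x\<^sub>i\<close> and \<open>f x\<^sub>j\<close>, as its symmetric part is \<open>- h/2\<close> times the
  symmetrization of \<open>f {x\<^sub>i, x\<^sub>j} = {f x\<^sub>i, f x\<^sub>j}\<close>.
\<close>

lemma free_lift_preserves_quant_ideal: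
  assumes f: "f \<in> carrier (PAut_gr br)" and p: "p \<in> quant_ideal c h"
  shows "free_lift f p \<in> quant_ideal c h"
proof (rule algebra_map_preserves_quant_ideal[OF algebra_map_free_lift _ p])
  fix i j
  let ?u = "\<lambda>i. f (x_var i)"
  have alg: "algebra_map f" and fbr: "\<And>p q. f (br p q) = br (f p) (f q)"
    using f by (auto simp: PAut_gr_iff)
  note u = PAut_gr_var_comp[OF f]
  have "br (?u i) (?u j) = (\<Sum>k\<in>UNIV. \<Sum>l\<in>UNIV. scalar (c i j k l) * (?u k * ?u l))"
    by (simp add: br_vars algebra_map_simps[OF alg] flip: fbr)
  then have "symmetrize (br (?u i) (?u j)) = (\<Sum>k\<in>UNIV. \<Sum>l\<in>UNIV. scalar (c i j k l) *
      (linear_lift (?u k) * linear_lift (?u l) + linear_lift (?u l) * linear_lift (?u k)))"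
    by (simp add: symmetrize_simps symmetrize_mult[OF u u])
  then have "quant_relator c h (\<lambda>i. linear_lift (?u i)) i j \<in> quant_ideal c h"
    using commutator_symmetrize_br[OF u u, of i j] by (simp add: quant_relator_def)
  then show "free_lift f (quant_relator c h y_var i j) \<in> quant_ideal c h"
    by (simp add: algebra_map_quant_relator algebra_map_free_lift) (simp add: free_lift_def)
qed

definition induced_aut where "induced_aut f = quant_map c h (free_lift f)"

lemma induced_aut_class:
  "f \<in> carrier (PAut_gr br) \<Longrightarrow> induced_aut f (quant_class c h p) = quant_class c h (free_lift f p)"
  unfolding induced_aut_def by (intro quant_map_class algebra_map_free_lift free_lift_preserves_quant_ideal)

lemma induced_aut_closed:
  assumes f: "f \<in> carrier (PAut_gr br)"
  shows "induced_aut f \<in> carrier (Aut_gr_quant c h)"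
proof -
  obtain g where g: "g \<in> carrier (PAut_gr br)" and inv: "\<And>p. f (g p) = p" "\<And>p. g (f p) = p"
    using PAut_gr_inverse[OF f] by metis
  have alg: "algebra_map f" "algebra_map g" using f g by (auto simp: PAut_gr_iff)
  have "free_lift f (free_lift g p) = p" "free_lift g (free_lift f p) = p" for p
    using free_lift_compose[of f g p, OF alg(1) PAut_gr_var_comp[OF g]]
      free_lift_compose[of g f p, OF alg(2) PAut_gr_var_comp[OF f]]
    by (simp_all add: inv free_lift_id)
  then show ?thesis
    unfolding induced_aut_def
    by (intro quant_map_graded_aut[where G = "free_lift g"] algebra_map_free_lift free_lift_comp
        free_lift_preserves_quant_ideal f g)
qed

lemma induced_aut_mult:
  assumes f: "f \<in> carrier (PAut_gr br)" and g: "g \<in> carrier (PAut_gr br)"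
  shows "induced_aut (f \<otimes>\<^bsub>PAut_gr br\<^esub> g) = induced_aut f \<otimes>\<^bsub>Aut_gr_quant c h\<^esub> induced_aut g"
proof -
  interpret P: group "PAut_gr br" by (rule group_PAut_gr)
  have alg: "algebra_map f" using f by (simp add: PAut_gr_iff)
  have fg: "f \<otimes>\<^bsub>PAut_gr br\<^esub> g \<in> carrier (PAut_gr br)" using f g by (rule P.m_closed)
  have "induced_aut (f \<otimes>\<^bsub>PAut_gr br\<^esub> g) u
      = compose (carrier (quantization c h)) (induced_aut f) (induced_aut g) u" for u
  proof (cases "u \<in> carrier (quantization c h)")
    case True
    then obtain p where u: "u = quant_class c h p" by (auto simp: carrier_quantization)
    have "induced_aut (f \<otimes>\<^bsub>PAut_gr br\<^esub> g) u = quant_class c h (free_lift (\<lambda>p. f (g p)) p)"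
      using induced_aut_class[OF fg] by (simp add: u PAut_gr_mult[OF f g])
    then show ?thesis
      by (simp add: u compose_eq induced_aut_class f g free_lift_compose[OF alg, of g, OF PAut_gr_var_comp[OF g]])
  next
    case False
    then show ?thesis by (simp add: induced_aut_def quant_map_def compose_def)
  qed
  then show ?thesis
    using f g by (auto simp: Aut_gr_quant_mult induced_aut_closed)
qed

text \<open>
  Linear forms embed into the quantization: on them \<open>dequantize\<close> is injective, and it factors
  through the quotient.
\<close>

lemma free_comp_1_quant_class_inj:
  assumes "p \<in> free_comp 1" "q \<in> free_comp 1" "quant_class c h p = quant_class c h q"
  shows "p = q"
proof -
  \<comment> \<open>on linear forms \<open>linear_lift\<close> inverts \<open>dequantize\<close>\<close>
  have "dequantize (p - q) = 0"
    using assms(3) by (intro dequantize_ideal) (simp add: quant_class_eq_iff)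
  then have "linear_lift (dequantize p) = linear_lift (dequantize q)" by (simp add: dequantize_linear)
  then show ?thesis using assms(1,2) by (simp only: dequantize_comp_1)
qed

lemma induced_aut_inj: "inj_on induced_aut (carrier (PAut_gr br))"
proof (rule inj_onI)
  fix f g assume f: "f \<in> carrier (PAut_gr br)" and g: "g \<in> carrier (PAut_gr br)"
    and eq: "induced_aut f = induced_aut g"
  have "f (x_var i) = g (x_var i)" for i
  proof -
    have "quant_class c h (free_lift f (y_var i)) = quant_class c h (free_lift g (y_var i))"
      using eq by (simp flip: induced_aut_class[OF f] induced_aut_class[OF g])
    then have "linear_lift (f (x_var i)) = linear_lift (g (x_var i))"
      by (intro free_comp_1_quant_class_inj linear_lift_comp) (simp add: free_lift_def)
    then have "dequantize (linear_lift (f (x_var i))) = dequantize (linear_lift (g (x_var i)))" by simp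
    then show ?thesis by (simp only: dequantize_linear_lift PAut_gr_var_comp f g)
  qed
  moreover have "algebra_map f" "algebra_map g" using f g by (auto simp: PAut_gr_iff)
  ultimately show "f = g" by (intro ext) (rule poly_algebra_map_eqI)
qed

text \<open>
  The image of a relation lies in the ideal, hence is killed by \<open>dequantize\<close>; since \<open>h \<noteq> 0\<close>, the
  value computed in \<open>dequantize_relator\<close> yields the compatibility with the bracket.
\<close>

lemma relator_image_preserves_br:
  assumes v: "\<And>i. v i \<in> free_comp 1"
    and ideal: "\<And>p. p \<in> quant_ideal c h \<Longrightarrow> free_hom v p \<in> quant_ideal c h"
  defines "f \<equiv> poly_hom (\<lambda>i. dequantize (v i))"
  shows "f (br p q) = br (f p) (f q)"
proof (rule algebra_map_preserves_br)
  show alg: "algebra_map f" by (simp add: f_def algebra_map_poly_hom)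
  fix i j
  let ?u = "\<lambda>i. dequantize (v i)"
  have "free_hom v (quant_relator c h y_var i j) = quant_relator c h (\<lambda>i. linear_lift (?u i)) i j"
    by (simp add: algebra_map_quant_relator algebra_map_free_hom dequantize_comp_1(2)[OF v])
  then have "dequantize (quant_relator c h (\<lambda>i. linear_lift (?u i)) i j) = 0"
    using dequantize_ideal[OF ideal[OF quant_relator_in_ideal]] by metis
  then have "scalar h * (br (?u i) (?u j) - (\<Sum>k\<in>UNIV. \<Sum>l\<in>UNIV. scalar (c i j k l) * (?u k * ?u l))) = 0"
    by (simp only: dequantize_relator[OF dequantize_comp_1(1)[OF v]])
  \<comment> \<open>multiplying by the scalar \<open>1 / h\<close> cancels the unit \<open>h\<close> of the polynomial ring\<close>
  then have "scalar (1 / h) * (scalar h * (br (?u i) (?u j) - (\<Sum>k\<in>UNIV. \<Sum>l\<in>UNIV. scalar (c i j k l) * (?u k * ?u l)))) = 0"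
    by simp
  then have "br (?u i) (?u j) = (\<Sum>k\<in>UNIV. \<Sum>l\<in>UNIV. scalar (c i j k l) * (?u k * ?u l))"
    using h_nonzero by (simp flip: mult.assoc scalar_mult)
  then show "f (br (x_var i) (x_var j)) = br (f (x_var i)) (f (x_var j))"
    by (simp add: br_vars algebra_map_simps[OF alg]) (simp add: f_def)
qed

text \<open>
  Lifts of mutually inverse automorphisms are mutually inverse only modulo the ideal, but on the
  generators the difference is a linear form in the ideal and therefore zero.
\<close>

lemma dequantize_inverse_lifts:
  assumes v: "\<And>i. v i \<in> free_comp 1" and w: "\<And>i. w i \<in> free_comp 1"
    and inv: "\<And>i. quant_class c h (free_hom w (free_hom v (y_var i))) = quant_class c h (y_var i)"
  shows "poly_hom (\<lambda>i. dequantize (w i)) (poly_hom (\<lambda>i. dequantize (v i)) p) = p"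
proof (rule poly_algebra_map_eqI[OF algebra_map_compose[OF algebra_map_poly_hom algebra_map_poly_hom] algebra_map_id])
  fix i
  let ?g = "poly_hom (\<lambda>i. dequantize (w i))"
  have lin: "free_lift ?g = free_hom w"
    by (simp add: free_lift_def dequantize_comp_1(2)[OF w])
  have "free_hom w (v i) = y_var i"
    using free_comp_1_quant_class_inj[OF free_hom_comp[OF w v] y_var_comp] inv[of i] by simp
  moreover have "free_hom w (v i) = linear_lift (?g (dequantize (v i)))"
    using free_lift_linear_lift[OF algebra_map_poly_hom dequantize_comp_1(1)[OF v]]
    by (metis lin dequantize_comp_1(2)[OF v])
  ultimately have "dequantize (linear_lift (?g (dequantize (v i)))) = x_var i" by simp
  moreover have "?g (dequantize (v i)) \<in> poly_comp 1"
    by (intro poly_hom_comp dequantize_comp_1(1) v w)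
  ultimately show "?g (poly_hom (\<lambda>i. dequantize (v i)) (x_var i)) = x_var i"
    by (simp add: dequantize_linear_lift)
qed

lemma induced_aut_surj:
  assumes \<phi>: "\<phi> \<in> carrier (Aut_gr_quant c h)"
  shows "\<exists>f\<in>carrier (PAut_gr br). induced_aut f = \<phi>"
proof -
  obtain \<psi> where \<psi>: "\<psi> \<in> carrier (Aut_gr_quant c h)"
    and inv: "\<And>p. \<phi> (\<psi> (quant_class c h p)) = quant_class c h p" "\<And>p. \<psi> (\<phi> (quant_class c h p)) = quant_class c h p"
    using Aut_gr_quant_inverse[OF \<phi>] by metis
  obtain v where v: "\<And>i. v i \<in> free_comp 1" "\<And>p. \<phi> (quant_class c h p) = quant_class c h (free_hom v p)"
      "\<And>p. p \<in> quant_ideal c h \<Longrightarrow> free_hom v p \<in> quant_ideal c h"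
    using Aut_gr_quant_lift[OF \<phi>] by metis
  \<comment> \<open>the inverse is lifted as well, because the matrix of \<open>v\<close> has to be shown to be invertible\<close>
  obtain w where w: "\<And>i. w i \<in> free_comp 1" "\<And>p. \<psi> (quant_class c h p) = quant_class c h (free_hom w p)"
    using Aut_gr_quant_lift[OF \<psi>] by metis
  let ?f = "poly_hom (\<lambda>i. dequantize (v i))" and ?g = "poly_hom (\<lambda>i. dequantize (w i))"
  have gf: "?g (?f p) = p" for p
    by (rule dequantize_inverse_lifts[OF v(1) w(1)]) (simp only: v(2)[symmetric] w(2)[symmetric] inv)
  have fg: "?f (?g p) = p" for p
    by (rule dequantize_inverse_lifts[OF w(1) v(1)]) (simp only: v(2)[symmetric] w(2)[symmetric] inv)
  have comp: "?f p \<in> poly_comp d" "?g p \<in> poly_comp d" if "p \<in> poly_comp d" for p d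
    using that by (intro poly_hom_comp dequantize_comp_1(1) v w; assumption)+
  have "?f ` poly_comp d = poly_comp d" for d
  proof
    show "poly_comp d \<subseteq> ?f ` poly_comp d"
    proof
      fix p :: "('n, 'k) polynom" assume "p \<in> poly_comp d"
      then show "p \<in> ?f ` poly_comp d"
        using imageI[OF comp(2), of p d ?f] by (simp only: fg)
    qed
  qed (use comp(1) in auto)
  moreover have "bij ?f" by (rule o_bij[of ?g]) (simp_all add: fun_eq_iff fg gf)
  ultimately have f: "?f \<in> carrier (PAut_gr br)"
    using relator_image_preserves_br[OF v(1) v(3)] by (simp add: PAut_gr_iff algebra_map_poly_hom)
  have lift: "free_lift ?f = free_hom v"
    by (simp add: free_lift_def dequantize_comp_1(2)[OF v(1)])
  have "induced_aut ?f u = \<phi> u" for u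
  proof (cases "u \<in> carrier (quantization c h)")
    case True
    then show ?thesis
      by (auto simp: carrier_quantization induced_aut_class[OF f] lift v(2))
  next
    case False
    moreover have "\<phi> \<in> extensional (carrier (quantization c h))"
      using \<phi> by (simp add: Aut_gr_quant_def graded_auts_def Bij_def)
    ultimately show ?thesis by (simp add: induced_aut_def quant_map_def extensional_def)
  qed
  then show ?thesis using f by blast
qed

text \<open>
  The isomorphism is constructed from the Poisson side, where the substitution can be read off
  directly from the values on the variables.
\<close>

lemma Aut_gr_quant_iso_PAut_gr: "Aut_gr_quant c h \<cong> PAut_gr br"
proof -
  have "induced_aut \<in> iso (PAut_gr br) (Aut_gr_quant c h)"
    unfolding iso_iff using induced_aut_closed induced_aut_surj
    by (auto simp: hom_def induced_aut_mult induced_aut_inj)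
  then have "PAut_gr br \<cong> Aut_gr_quant c h" by (rule is_isoI)
  then show ?thesis by (rule group.iso_sym[OF group_PAut_gr])
qed

end

theorem lemma2p1:
  fixes br :: "(3, 'k::{alg_closed_field, field_char_0}) polynom \<Rightarrow> (3, 'k) polynom \<Rightarrow> (3, 'k) polynom"
    and c :: "3 \<Rightarrow> 3 \<Rightarrow> 3 \<Rightarrow> 3 \<Rightarrow> 'k"
    and h :: 'k
  assumes "quadratic_poisson_bracket br"
    and "\<And>i j. br (x_var i) (x_var j)
           = (\<Sum>k\<in>UNIV. \<Sum>l\<in>UNIV. scalar (c i j k l) * (x_var k * x_var l))"
    and "h \<noteq> 0"
  shows "Aut_gr_quant c h \<cong> PAut_gr br"
proof -
  interpret quadratic_poisson_bracket br by (rule assms(1))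
  interpret quantized_bracket br c h
    by unfold_locales (use assms(2,3) in auto)
  show ?thesis by (rule Aut_gr_quant_iso_PAut_gr)
qed

end
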